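(* Let $-\tfrac12<\alpha<0$ and let $n\in\mathbb{N}$ with $n\ge2$. Suppose $h,g$ are analytic in $\mathbb{D}=\{|z|<1\}$ with $\operatorname{Re}\big(1+\frac{zh''(z)}{h'(z)}\big)>\alpha$ for all $z\in\mathbb{D}$ and $g'(z)=z^nh'(z)$ for all $z\in\mathbb{D}$. Then $f=h+\overline{g}$ is close-to-convex in the disk $$|z|<\sqrt[n]{\frac{1+2\alpha}{1+2n+2\alpha}}.$$
   Context: A domain $\Omega$ is close-to-convex if $\mathbb{C}\setminus\Omega$ is a union of non-intersecting half-lines. A harmonic function is close-to-convex in a disk if it is injective there and maps that disk onto a close-to-convex domain. *)

theory Defs
  imports "HOL-Complex_Analysis.Complex_Analysis"
begin

definition half_line :: "complex set \<Rightarrow> bool" where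
  "half_line L \<longleftrightarrow> (\<exists>a d. d \<noteq> 0 \<and> L = {a + complex_of_real t * d | t. t \<ge> 0})"

definition close_to_convex_domain :: "complex set \<Rightarrow> bool" where
  "close_to_convex_domain \<Omega> \<longleftrightarrow>
     (\<exists>R. (\<forall>L\<in>R. half_line L) \<and> pairwise disjnt R \<and> \<Union>R = - \<Omega>)"

definition close_to_convex_in :: "(complex \<Rightarrow> complex) \<Rightarrow> complex set \<Rightarrow> bool" where
  "close_to_convex_in f D \<longleftrightarrow> inj_on f D \<and> close_to_convex_domain (f ` D)"

end

theory Submission
  imports Defs
begin

text \<open>
  On the circle \<open>|z| = \<rho>\<close> of the critical radius the tangent angle \<open>\<psi>\<close> of the curve
  \<open>\<theta> \<mapsto> f(\<rho> e\<^sup>i\<^sup>\<theta>)\<close> satisfies \<open>\<psi>' > -1/2\<close> and increases by \<open>2\<pi>\<close> over a period. Hence the angles at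
  which \<open>\<psi>\<close> is not increasing cover less than \<open>\<pi>\<close>, and there is a direction \<open>\<beta>\<close> to which the curve is
  tangent exactly twice: the coordinate of \<open>f\<close> orthogonal to \<open>\<beta>\<close> increases along one arc of the circle
  and decreases along the other. This coordinate is the imaginary part of the analytic function
  \<open>F = e\<^sup>-\<^sup>i\<^sup>\<beta> h - e\<^sup>i\<^sup>\<beta> g\<close>, so by the minimum principle \<open>F\<close> satisfies the Royster-Ziegler
  condition, is injective and has an image that is convex in the horizontal direction. The function
  \<open>e\<^sup>-\<^sup>i\<^sup>\<beta> f\<close> differs from \<open>F\<close> by a real-valued function, and shearing preserves both properties.
  Finally the complement of a bounded domain convex in one direction is a union of disjoint
  half-lines.
\<close>

section \<open>Levels of functions with small negative slope\<close>

text \<open>A Sard-type estimate. Cut \<open>{a..b}\<close> into pieces so short that uniform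
  continuity of \<open>f'\<close> raises the bound \<open>l\<close> to at most \<open>m\<close> on
  every piece meeting \<open>S\<close>; each such piece has its image in an interval of length
  \<open>m * w\<close>. Passing to a Borel superset \<open>K\<close> avoids any claim that the image
  of \<open>S\<close> is measurable.\<close>

lemma image_small_derivative_cover:
  fixes f f' :: "real \<Rightarrow> real"
  assumes ab: "a < b" and der: "\<And>t. (f has_real_derivative f' t) (at t)"
    and cont: "continuous_on UNIV f'"
    and S: "S \<subseteq> {a..b}" "\<And>t. t \<in> S \<Longrightarrow> \<bar>f' t\<bar> \<le> l" and lm: "l < m" "0 \<le> m"
  shows "\<exists>K. K \<in> sets lborel \<and> f ` S \<subseteq> K \<and> emeasure lborel K \<le> ennreal (m * (b - a))"
proof -
  have "uniformly_continuous_on {a..b} f'"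
    by (rule compact_uniformly_continuous) (use cont continuous_on_subset in auto)
  then obtain d where d: "d > 0" and
    dd: "\<And>s t. s \<in> {a..b} \<Longrightarrow> t \<in> {a..b} \<Longrightarrow> dist s t < d \<Longrightarrow> dist (f' s) (f' t) < m - l"
    unfolding uniformly_continuous_on_def using lm by (metis diff_gt_0_iff_gt)
  obtain N where N: "(b - a) / d < real N"
    using reals_Archimedean2 by blast
  then have N0: "N > 0"
    using ab d by (metis bot_nat_0.not_eq_extremum diff_gt_0_iff_gt divide_pos_pos less_asym of_nat_0)
  define w where "w = (b - a) / N"
  have w: "w > 0" "w < d" "N * w = b - a"
    using N N0 ab d by (auto simp: w_def field_simps)
  define T where "T i = {a + real i * w .. a + (real i + 1) * w}" for i
  define c where "c i = a + real i * w + w / 2" for i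
  define K where "K i = {f (c i) - m * w / 2 .. f (c i) + m * w / 2}" for i
  define I where "I = {i. i < N \<and> S \<inter> T i \<noteq> {}}"
  have Tsub: "T i \<subseteq> {a..b}" if "i < N" for i
  proof -
    have "(real i + 1) * w \<le> N * w"
      using that w by (intro mult_right_mono) auto
    then show ?thesis
      using w ab by (auto simp: T_def algebra_simps add_increasing2 add_increasing)
  qed
  have fT: "f t \<in> K i" if i: "i \<in> I" and t: "t \<in> T i" for i t
  proof -
    obtain s where s: "s \<in> S" "s \<in> T i" using i by (auto simp: I_def)
    have iN: "i < N" using i by (auto simp: I_def)
    have bd: "\<bar>f' x\<bar> \<le> m" if "x \<in> T i" for x
    proof -
      have "dist x s < d" using that s w by (auto simp: T_def dist_real_def algebra_simps)
      then have "dist (f' x) (f' s) < m - l"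
        using dd that s Tsub[OF iN] by blast
      then show ?thesis using S(2)[OF s(1)] by (auto simp: dist_real_def)
    qed
    have cT: "c i \<in> T i" using w by (auto simp: c_def T_def algebra_simps)
    have "norm (f t - f (c i)) \<le> m * norm (t - c i)"
    proof (rule field_differentiable_bound[where S="T i" and f'=f'])
      show "(f has_real_derivative f' z) (at z within T i)" for z
        using der has_field_derivative_at_within by blast
    qed (use bd t cT in \<open>auto simp: T_def\<close>)
    moreover have "\<bar>t - c i\<bar> \<le> w / 2"
      using t unfolding T_def c_def abs_le_iff by (auto simp: algebra_simps)
    then have "m * norm (t - c i) \<le> m * (w / 2)"
      using lm by (intro mult_left_mono) auto
    ultimately show ?thesis by (auto simp: K_def abs_le_iff)
  qed
  have "f ` S \<subseteq> (\<Union>i\<in>I. K i)"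
  proof
    fix y assume "y \<in> f ` S"
    then obtain t where t: "t \<in> S" "y = f t" by auto
    have tab: "a \<le> t" "t \<le> b" using t S by auto
    have "\<exists>i<N. t \<in> T i"
    \<comment> \<open>At the right endpoint the floor index used below would be \<open>N\<close>,
      one too many, so that point goes to the last piece.\<close>
    proof (cases "t = b")
      case True
      have "real (N - 1) = real N - 1" using N0 by (simp add: of_nat_diff)
      then have "t \<in> T (N - 1)" using w True by (auto simp: T_def algebra_simps)
      then show ?thesis using N0 by (intro exI[of _ "N - 1"]) auto
    next
      case False
      define i where "i = nat \<lfloor>(t - a) / w\<rfloor>"
      have ri: "real i = of_int \<lfloor>(t - a) / w\<rfloor>" using tab w by (simp add: i_def)
      have 1: "real i \<le> (t - a) / w" "(t - a) / w < real i + 1" unfolding ri by linarith+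
      then have "t \<in> T i" using w by (auto simp: T_def field_simps)
      moreover have "real i * w \<le> t - a" using 1 w by (simp add: field_simps)
      then have "real i * w < N * w" using w tab False by linarith
      then have "i < N" using w(1) by (simp only: mult_less_cancel_right_pos of_nat_less_iff)
      ultimately show ?thesis by blast
    qed
    then obtain i where "i < N" "t \<in> T i" by blast
    then have "i \<in> I" using t by (auto simp: I_def)
    then show "y \<in> (\<Union>i\<in>I. K i)" using fT \<open>t \<in> T i\<close> t by blast
  qed
  moreover have "emeasure lborel (\<Union>i\<in>I. K i) \<le> ennreal (m * (b - a))"
  proof -
    have finI: "finite I" "card I \<le> N"
      using card_mono[of "{..<N}" I] by (auto simp: I_def)
    have mw: "m * w \<ge> 0" using lm w by simp
    have "emeasure lborel (\<Union>i\<in>I. K i) \<le> (\<Sum>i\<in>I. emeasure lborel (K i))"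
      by (rule emeasure_subadditive_finite) (use finI in \<open>auto simp: K_def\<close>)
    also have "\<dots> = (\<Sum>i\<in>I. ennreal (m * w))"
      using mw by (intro sum.cong) (auto simp: K_def)
    also have "\<dots> = ennreal (\<Sum>i\<in>I. m * w)"
      using mw by (intro sum_ennreal) auto
    also have "(\<Sum>i\<in>I. m * w) \<le> N * (m * w)"
      using finI mw by (simp add: mult_right_mono)
    also have "N * (m * w) = m * (b - a)" using w by (simp add: mult.left_commute)
    finally show ?thesis by (simp add: ennreal_leI)
  qed
  moreover have "(\<Union>i\<in>I. K i) \<in> sets lborel"
    by (intro sets.finite_UN) (auto simp: I_def K_def)
  ultimately show ?thesis by blast
qed

section \<open>Level crossings of a function that gains 2 pi per period\<close>

lemma periodic_shift:
  fixes \<psi> :: "real \<Rightarrow> real"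
  assumes "\<And>t. \<psi> (t + 2 * pi) = \<psi> t + 2 * pi"
  shows "\<psi> (t + 2 * pi * of_int k) = \<psi> t + 2 * pi * of_int k"
proof (induction k rule: int_induct[where k=0])
  case (step1 i)
  then show ?case using assms[of "t + 2 * pi * of_int i"] by (simp add: algebra_simps)
next
  case (step2 i)
  then show ?case using assms[of "t + 2 * pi * of_int (i - 1)"] by (simp add: algebra_simps)
qed simp

text \<open>Just to the right of \<open>s\<close> the function exceeds \<open>c\<close>. A later
  value at most \<open>c\<close> would force a first return to the level, reached from above,
  against the positive slope required there.\<close>

lemma upcrossing_stays_above:
  fixes \<psi> \<psi>' :: "real \<Rightarrow> real"
  assumes der: "\<And>t. (\<psi> has_real_derivative \<psi>' t) (at t)"
    and up: "\<And>t. \<psi> t = c \<Longrightarrow> \<psi>' t > 0" and s: "\<psi> s = c" and t: "s < t"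
  shows "\<psi> t > c"
proof (rule ccontr)
  assume "\<not> c < \<psi> t"
  then have tc: "\<psi> t \<le> c" by simp
  have cont: "continuous_on A \<psi>" for A
    using der by (meson DERIV_isCont continuous_at_imp_continuous_on)
  obtain d where d: "d > 0" "\<And>h. h > 0 \<Longrightarrow> h < d \<Longrightarrow> \<psi> s < \<psi> (s + h)"
    using DERIV_pos_inc_right[OF der up[OF s]] by blast
  define p where "p = s + min (d / 2) ((t - s) / 2)"
  have p: "s < p" "p < t" "\<psi> p > c"
    using d(1) t d(2)[of "min (d / 2) ((t - s) / 2)"] s by (auto simp: p_def min_def field_simps)
  define Z where "Z = {x \<in> {p..t}. \<psi> x = c}"
  have "compact Z"
  proof -
    have "closed Z" unfolding Z_def
      by (rule continuous_closed_preimage_constant) (use cont in auto)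
    moreover have "bounded Z" unfolding Z_def by (rule bounded_subset[of "{p..t}"]) auto
    ultimately show ?thesis by (simp add: compact_eq_bounded_closed)
  qed
  moreover have "Z \<noteq> {}"
    using IVT2'[of \<psi> t c p] p tc cont by (auto simp: Z_def)
  ultimately obtain x where x: "x \<in> Z" "\<And>y. y \<in> Z \<Longrightarrow> x \<le> y"
    by (meson compact_attains_inf)
  have xc: "\<psi> x = c" "p \<le> x" "x \<le> t" using x by (auto simp: Z_def)
  then have px: "p < x" using p by (cases "p = x") auto
  obtain e where e: "e > 0" "\<And>h. h > 0 \<Longrightarrow> h < e \<Longrightarrow> \<psi> (x - h) < \<psi> x"
    using DERIV_pos_inc_left[OF der up[OF xc(1)]] by blast
  \<comment> \<open>\<open>y\<close> lies just left of the first return \<open>x\<close> and already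
    below \<open>c\<close>, so the level is also attained between \<open>p\<close> and
    \<open>y\<close>, that is before \<open>x\<close>.\<close>
  define y where "y = x - min (e / 2) ((x - p) / 2)"
  have y: "p < y" "y < x" "\<psi> y < c"
    using e(1) px e(2)[of "min (e / 2) ((x - p) / 2)"] xc by (auto simp: y_def min_def field_simps)
  then obtain z where "p \<le> z" "z \<le> y" "\<psi> z = c"
    using IVT2'[of \<psi> y c p] p cont by auto
  then show False using x(2)[of z] y xc by (auto simp: Z_def)
qed

text \<open>
  On the set where \<open>\<psi>' \<le> 0\<close> one has \<open>\<bar>\<psi>'\<bar> < 1/2\<close>, so the values of \<open>\<psi>\<close> on it have density less
  than \<open>1/2\<close> on long intervals; together with their translate by \<open>- \<pi>\<close> they cannot cover the line.
\<close>
lemma transversal_level: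
  fixes \<psi> \<psi>' :: "real \<Rightarrow> real"
  assumes der: "\<And>t. (\<psi> has_real_derivative \<psi>' t) (at t)" and cont: "continuous_on UNIV \<psi>'"
    and per: "\<And>t. \<psi> (t + 2 * pi) = \<psi> t + 2 * pi" and low: "\<And>t. \<psi>' t > - 1 / 2"
  shows "\<exists>c. \<forall>t. \<psi> t = c \<or> \<psi> t = c + pi \<longrightarrow> \<psi>' t > 0"
proof (rule ccontr)
  assume neg: "\<not> ?thesis"
  have cont\<psi>: "continuous_on A \<psi>" for A
    using der by (meson DERIV_isCont continuous_at_imp_continuous_on)
  have per': "\<psi>' (t + 2 * pi) = \<psi>' t" for t
  proof -
    have "((\<lambda>x. \<psi> (x + 2 * pi)) has_real_derivative \<psi>' (t + 2 * pi)) (at t)"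
      using der DERIV_shift by blast
    moreover have "((\<lambda>x. \<psi> (x + 2 * pi)) has_real_derivative \<psi>' t) (at t)"
      unfolding per by (auto intro!: derivative_eq_intros der)
    ultimately show ?thesis by (rule DERIV_unique)
  qed
  have per'k: "\<psi>' (t + 2 * pi * of_int k) = \<psi>' t" for t k
  proof (induction k rule: int_induct[where k=0])
    case (step1 i)
    then show ?case using per'[of "t + 2 * pi * of_int i"] by (simp add: algebra_simps)
  next
    case (step2 i)
    then show ?case using per'[of "t + 2 * pi * of_int (i - 1)"] by (simp add: algebra_simps)
  qed simp
  have red: "\<exists>k. t + 2 * pi * of_int k \<in> {0..2 * pi}" for t :: real
  proof (intro exI)
    show "t + 2 * pi * of_int (- \<lfloor>t / (2 * pi)\<rfloor>) \<in> {0..2 * pi}"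
    proof -
      have "of_int \<lfloor>t / (2 * pi)\<rfloor> * (2 * pi) \<le> t" "t < (of_int \<lfloor>t / (2 * pi)\<rfloor> + 1) * (2 * pi)"
        by (rule floor_divide_lower floor_divide_upper; simp)+
      then show ?thesis by (auto simp: algebra_simps)
    qed
  qed
  obtain t0 where t0: "\<forall>t\<in>{0..2 * pi}. \<psi>' t0 \<le> \<psi>' t"
  proof -
    have "{0..2 * pi} \<noteq> {}" by simp
    then show thesis
      using continuous_attains_inf[OF compact_Icc _ continuous_on_subset[OF cont subset_UNIV]] that
      by metis
  qed
  have low': "\<psi>' t0 \<le> \<psi>' t" for t using red[of t] t0 per'k[of t] by fastforce
  \<comment> \<open>\<open>l\<close> bounds the modulus of the slope where it is not positive, and
    \<open>m\<close> is the midpoint of \<open>l\<close> and 1/2: \<open>l < m\<close> feeds the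
    covering lemma, and \<open>m < 1 / 2\<close> keeps two copies of the exceptional values below
    full density.\<close>
  define l where "l = max 0 (- \<psi>' t0)"
  define m where "m = (l + 1 / 2) / 2"
  have lm: "l \<ge> 0" "l < m" "m < 1 / 2" using low[of t0] by (auto simp: l_def m_def max_def)
  \<comment> \<open>\<open>\<psi> t - t\<close> is continuous and 2 pi periodic, hence
    bounded.\<close>
  obtain C where C: "\<And>t. \<bar>\<psi> t - t\<bar> \<le> C" "C \<ge> 0"
  proof -
    have "compact ((\<lambda>t. \<psi> t - t) ` {0..2 * pi})"
      by (intro compact_continuous_image continuous_intros cont\<psi>) auto
    then obtain B where B: "\<And>t. t \<in> {0..2 * pi} \<Longrightarrow> \<bar>\<psi> t - t\<bar> \<le> B"
      by (metis (no_types, lifting) bounded_iff compact_imp_bounded image_eqI real_norm_def)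
    have "\<bar>\<psi> t - t\<bar> \<le> B" for t
    proof -
      obtain k where "t + 2 * pi * of_int k \<in> {0..2 * pi}" using red by blast
      from B[OF this] show ?thesis using periodic_shift[of \<psi>, OF per, of t k] by simp
    qed
    moreover have "B \<ge> 0" using B[of 0] by auto
    ultimately show thesis using that by blast
  qed
  \<comment> \<open>\<open>M\<close> is so large that two sets of measure at most
    \<open>m * (M + 2 * C + 4)\<close> cannot cover \<open>{0..M}\<close>; the 4 absorbs the shift
    by \<open>pi\<close>.\<close>
  obtain M :: nat where M: "(2 * C + 4) / (1 - 2 * m) < real M"
    using reals_Archimedean2 by blast
  have M': "2 * C + 4 < M * (1 - 2 * m)" using M lm by (simp add: field_simps)
  \<comment> \<open>As \<psi> moves points by at most \<open>C\<close>, this interval contains every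
    \<open>t\<close> with \<open>\<psi> t\<close> in \<open>{0..M + 4}\<close>.\<close>
  define S where "S = {t \<in> {- C .. M + C + 4}. \<psi>' t \<le> 0}"
  have "\<exists>K. K \<in> sets lborel \<and> \<psi> ` S \<subseteq> K \<and>
      emeasure lborel K \<le> ennreal (m * ((M + C + 4) - (- C)))"
  proof (rule image_small_derivative_cover[OF _ der cont])
    show "\<bar>\<psi>' t\<bar> \<le> l" if "t \<in> S" for t
      using that low'[of t] by (auto simp: S_def l_def)
  qed (use C lm in \<open>auto simp: S_def\<close>)
  then obtain K where K: "K \<in> sets borel" "\<psi> ` S \<subseteq> K"
    "emeasure lborel K \<le> ennreal (m * (M + C + 4 + C))" by auto
  have "{0..real M} \<subseteq> K \<union> (\<lambda>x. x + pi) -` K"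
  proof
    fix c assume c: "c \<in> {0..real M}"
    obtain t where t: "\<psi> t = c \<or> \<psi> t = c + pi" "\<psi>' t \<le> 0"
      using neg by (meson linorder_not_less)
    have "0 \<le> \<psi> t" "\<psi> t \<le> M + 4"
      using t(1) c pi_less_4 pi_gt_zero by (elim disjE; simp)+
    then have "t \<in> S" using C(1)[of t] t(2) by (simp add: S_def abs_le_iff)
    then have "\<psi> t \<in> K" using K by blast
    then show "c \<in> K \<union> (\<lambda>x. x + pi) -` K" using t by auto
  qed
  moreover have m2: "(\<lambda>x. x + pi) -` K \<in> sets borel"
    using K by (intro measurable_sets_borel[of _ borel]) auto
  ultimately have "emeasure lborel {0..real M} \<le> emeasure lborel (K \<union> (\<lambda>x. x + pi) -` K)"
    using K by (intro emeasure_mono) auto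
  also have "\<dots> \<le> emeasure lborel K + emeasure lborel ((\<lambda>x. x + pi) -` K)"
    using K m2 by (intro emeasure_subadditive) auto
  also have "emeasure lborel ((\<lambda>x. x + pi) -` K) = emeasure lborel K"
  proof -
    have plus: "(+) pi = (\<lambda>x. x + pi)" by (simp add: fun_eq_iff)
    have "emeasure lborel K = emeasure (distr lborel borel ((+) pi)) K"
      by (simp add: lborel_distr_plus)
    also have "\<dots> = emeasure lborel ((\<lambda>x. x + pi) -` K)"
      using K by (subst emeasure_distr) (auto simp: plus)
    finally show ?thesis by simp
  qed
  also have "emeasure lborel K + emeasure lborel K \<le>
      ennreal (m * (M + C + 4 + C)) + ennreal (m * (M + C + 4 + C))"
    using K by (intro add_mono) auto
  also have "\<dots> = ennreal (2 * (m * (M + C + 4 + C)))"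
    using lm C by (subst ennreal_plus[symmetric]) auto
  finally have "real M \<le> 2 * (m * (M + C + 4 + C))"
    using lm C by (simp add: ennreal_le_iff)
  moreover have "m * (2 * C + 4) \<le> 1 / 2 * (2 * C + 4)"
    using lm C by (intro mult_right_mono) auto
  ultimately show False using M' C by (auto simp: algebra_simps)
qed

text \<open>At the levels \<open>c\<close> and \<open>c + pi\<close> given by
  \<open>transversal_level\<close> all crossings go upwards, so each is met exactly once, at
  \<open>s\<close> and \<open>t\<close>; the level \<open>c + 2 * pi\<close> is met at
  \<open>s + 2 * pi\<close>. One period thus splits into two arcs, each with values within a
  half-turn.\<close>

lemma half_turns:
  fixes \<psi> \<psi>' :: "real \<Rightarrow> real"
  assumes der: "\<And>t. (\<psi> has_real_derivative \<psi>' t) (at t)" and cont: "continuous_on UNIV \<psi>'"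
    and per: "\<And>t. \<psi> (t + 2 * pi) = \<psi> t + 2 * pi" and low: "\<And>t. \<psi>' t > - 1 / 2"
  obtains c s t where "s < t" "t < s + 2 * pi"
    "\<And>x. s \<le> x \<Longrightarrow> x \<le> t \<Longrightarrow> c \<le> \<psi> x \<and> \<psi> x \<le> c + pi"
    "\<And>x. t \<le> x \<Longrightarrow> x \<le> s + 2 * pi \<Longrightarrow> c + pi \<le> \<psi> x \<and> \<psi> x \<le> c + 2 * pi"
proof -
  obtain c where c: "\<And>t. \<psi> t = c \<Longrightarrow> \<psi>' t > 0" "\<And>t. \<psi> t = c + pi \<Longrightarrow> \<psi>' t > 0"
    using transversal_level[OF assms] by blast
  have cont\<psi>: "continuous_on A \<psi>" for A
    using der by (meson DERIV_isCont continuous_at_imp_continuous_on)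
  have surj: "\<exists>t. \<psi> t = y" for y
  proof -
    define k where "k = \<lceil>(\<bar>y\<bar> + \<bar>\<psi> 0\<bar>) / (2 * pi)\<rceil>"
    have "(\<bar>y\<bar> + \<bar>\<psi> 0\<bar>) / (2 * pi) \<le> of_int k" unfolding k_def by linarith
    then have k: "\<bar>y\<bar> + \<bar>\<psi> 0\<bar> \<le> 2 * pi * of_int k" by (simp add: field_simps)
    have "\<psi> (- (2 * pi * of_int k)) \<le> y" "y \<le> \<psi> (2 * pi * of_int k)"
      using periodic_shift[of \<psi>, OF per, of 0 k] periodic_shift[of \<psi>, OF per, of 0 "- k"] k by auto
    moreover have "- (2 * pi * of_int k) \<le> 2 * pi * of_int k" using k by simp
    ultimately show ?thesis using IVT'[of \<psi>] cont\<psi> by metis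
  qed
  \<comment> \<open>Moving \<open>x\<close> back by \<open>k\<close> periods brings the value down
    to at most \<open>d\<close>, so \<open>d\<close> is attained at or before \<open>x\<close>; from
    there on \<psi> would stay above \<open>d\<close>, contradicting
    \<open>\<psi> s = d\<close>.\<close>
  have before: "\<psi> x < d" if up: "\<And>t. \<psi> t = d \<Longrightarrow> \<psi>' t > 0" and s: "\<psi> s = d" and x: "x < s" for d s x
  proof (rule ccontr)
    assume "\<not> \<psi> x < d"
    then have xd: "\<psi> x \<ge> d" by simp
    define k where "k = \<lceil>(\<psi> x - d) / (2 * pi)\<rceil>"
    have "(\<psi> x - d) / (2 * pi) \<le> of_int k" unfolding k_def by linarith
    then have k: "\<psi> x - d \<le> 2 * pi * of_int k" by (simp add: field_simps)
    then have k0: "2 * pi * of_int k \<ge> 0" using xd by linarith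
    have "\<psi> (x - 2 * pi * of_int k) \<le> d"
      using periodic_shift[of \<psi>, OF per, of x "- k"] k by simp
    then obtain y where "y \<le> x" "\<psi> y = d"
      using IVT'[of \<psi> "x - 2 * pi * of_int k" d x] xd k0 cont\<psi> by auto
    then show False using upcrossing_stays_above[where s=y and t=s and c=d, OF der up] s x by auto
  qed
  obtain s t where st: "\<psi> s = c" "\<psi> t = c + pi" using surj by blast
  have s2: "\<psi> (s + 2 * pi) = c + 2 * pi" using per st by simp
  have after_s: "\<psi> x > c" if "x > s" for x using upcrossing_stays_above[OF der c(1) st(1) that] .
  have after_t: "\<psi> x > c + pi" if "x > t" for x using upcrossing_stays_above[OF der c(2) st(2) that] .
  have before_t: "\<psi> x < c + pi" if "x < t" for x using before[OF c(2) st(2) that] .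
  have before_s: "\<psi> x < c + 2 * pi" if "x < s + 2 * pi" for x
    using before[OF c(1) st(1), of "x - 2 * pi"] that per[of "x - 2 * pi"] by simp
  have 1: "s < t" using after_t[of s] st by (cases s t rule: linorder_cases) auto
  have 2: "t < s + 2 * pi" using before_t[of "s + 2 * pi"] s2 st by (cases t "s + 2 * pi" rule: linorder_cases) auto
  show thesis
  proof (rule that[OF 1 2, of c])
    show "c \<le> \<psi> x \<and> \<psi> x \<le> c + pi" if "s \<le> x" "x \<le> t" for x
      using that st after_s[of x] before_t[of x] by (cases "x = s"; cases "x = t") auto
    show "c + pi \<le> \<psi> x \<and> \<psi> x \<le> c + 2 * pi" if "t \<le> x" "x \<le> s + 2 * pi" for x
      using that st s2 after_t[of x] before_s[of x] by (cases "x = t"; cases "x = s + 2 * pi") auto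
  qed
qed

section \<open>Horizontally convex sets\<close>

text \<open>This is convexity in the direction of the real axis; the set itself need not be
  convex.\<close>

definition horizontally_convex :: "complex set \<Rightarrow> bool" where
  "horizontally_convex \<Omega> \<longleftrightarrow>
     (\<forall>x1 x x2 y. Complex x1 y \<in> \<Omega> \<longrightarrow> Complex x2 y \<in> \<Omega> \<longrightarrow> x1 \<le> x \<longrightarrow> x \<le> x2 \<longrightarrow> Complex x y \<in> \<Omega>)"

lemma half_line_right: "half_line {z. Im z = y \<and> Re z \<ge> x}"
  unfolding half_line_def
proof (intro exI conjI)
  have "z \<in> {Complex x y + complex_of_real t * 1 | t. t \<ge> 0}" if "z \<in> {z. Im z = y \<and> x \<le> Re z}" for z
    using that by (intro CollectI exI[of _ "Re z - x"]) (auto simp: complex_eq_iff)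
  then show "{z. Im z = y \<and> x \<le> Re z} = {Complex x y + complex_of_real t * 1 | t. t \<ge> 0}"
    by auto
qed simp

lemma half_line_rotate:
  assumes "half_line L" and "c \<noteq> 0"
  shows "half_line ((*) c ` L)"
proof -
  obtain a d where L: "d \<noteq> 0" "L = {a + complex_of_real t * d | t. t \<ge> 0}"
    using assms by (auto simp: half_line_def)
  have "(*) c ` L = {c * a + complex_of_real t * (c * d) | t. t \<ge> 0}"
    unfolding L setcompr_eq_image image_image by (simp add: algebra_simps)
  moreover have "c * d \<noteq> 0" using L assms by simp
  ultimately show ?thesis unfolding half_line_def by blast
qed

text \<open>A nonzero factor acts bijectively on the plane and carries half-lines to half-lines, so
  a decomposition of the complement is carried along. This lets the main proof work in a rotated
  frame.\<close>

lemma close_to_convex_domain_rotate: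
  assumes "close_to_convex_domain \<Omega>" and c: "c \<noteq> 0"
  shows "close_to_convex_domain ((*) c ` \<Omega>)"
proof -
  obtain R where R: "\<And>L. L \<in> R \<Longrightarrow> half_line L" "pairwise disjnt R" "\<Union>R = - \<Omega>"
    using assms by (auto simp: close_to_convex_domain_def)
  have inj: "inj ((*) c)" and bij: "bij ((*) c)"
    using c by (auto simp: inj_def intro!: o_bij[of "\<lambda>z. z / c"])
  show ?thesis
    unfolding close_to_convex_domain_def
  proof (intro exI conjI ballI)
    show "half_line L" if "L \<in> (`) ((*) c) ` R" for L
      using that R half_line_rotate c by auto
    show "pairwise disjnt ((`) ((*) c) ` R)"
    proof (rule pairwiseI)
      fix A B assume "A \<in> (`) ((*) c) ` R" "B \<in> (`) ((*) c) ` R" "A \<noteq> B"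
      then obtain L M where "L \<in> R" "M \<in> R" "L \<noteq> M" "A = (*) c ` L" "B = (*) c ` M"
        by blast
      then show "disjnt A B"
        using R(2) image_Int[OF inj, of L M] by (auto simp: pairwise_def disjnt_def)
    qed
    show "\<Union>((`) ((*) c) ` R) = - (*) c ` \<Omega>"
      using R(3) bij by (metis bij_image_Compl_eq image_Union)
  qed
qed

lemma half_line_left: "half_line {z. Im z = y \<and> Re z \<le> x}"
  unfolding half_line_def
proof (intro exI conjI)
  have "z \<in> {Complex x y + complex_of_real t * (-1) | t. t \<ge> 0}" if "z \<in> {z. Im z = y \<and> Re z \<le> x}" for z
    using that by (intro CollectI exI[of _ "x - Re z"]) (auto simp: complex_eq_iff)
  then show "{z. Im z = y \<and> Re z \<le> x} = {Complex x y + complex_of_real t * (-1) | t. t \<ge> 0}"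
    by auto
qed simp

lemma half_line_up: "half_line {z. Re z = x \<and> Im z \<ge> y}"
  unfolding half_line_def
proof (intro exI conjI)
  have "z \<in> {Complex x y + complex_of_real t * \<i> | t. t \<ge> 0}" if "z \<in> {z. Re z = x \<and> Im z \<ge> y}" for z
    using that by (intro CollectI exI[of _ "Im z - y"]) (auto simp: complex_eq_iff)
  then show "{z. Re z = x \<and> Im z \<ge> y} = {Complex x y + complex_of_real t * \<i> | t. t \<ge> 0}"
    by auto
qed simp

lemma half_line_down: "half_line {z. Re z = x \<and> Im z \<le> y}"
  unfolding half_line_def
proof (intro exI conjI)
  have "z \<in> {Complex x y + complex_of_real t * (-\<i>) | t. t \<ge> 0}" if "z \<in> {z. Re z = x \<and> Im z \<le> y}" for z
    using that by (intro CollectI exI[of _ "y - Im z"]) (auto simp: complex_eq_iff)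
  then show "{z. Re z = x \<and> Im z \<le> y} = {Complex x y + complex_of_real t * (-\<i>) | t. t \<ge> 0}"
    by auto
qed simp

lemma bounded_open_connected_real:
  fixes S :: "real set"
  assumes "open S" "bounded S" "connected S" "S \<noteq> {}"
  shows "S = {Inf S<..<Sup S}"
proof -
  have bdd: "bdd_below S" "bdd_above S"
    using assms bounded_imp_bdd_below bounded_imp_bdd_above by auto
  have no: "Inf S \<notin> S" "Sup S \<notin> S"
  proof -
    show "Inf S \<notin> S"
    proof
      assume "Inf S \<in> S"
      then obtain e where "e > 0" "ball (Inf S) e \<subseteq> S" using assms open_contains_ball by blast
      then have "Inf S - e / 2 \<in> S" by (auto simp: subset_iff dist_real_def)
      then show False using cInf_lower[OF _ bdd(1)] \<open>e > 0\<close> by fastforce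
    qed
    show "Sup S \<notin> S"
    proof
      assume "Sup S \<in> S"
      then obtain e where "e > 0" "ball (Sup S) e \<subseteq> S" using assms open_contains_ball by blast
      then have "Sup S + e / 2 \<in> S" by (auto simp: subset_iff dist_real_def)
      then show False using cSup_upper[OF _ bdd(2)] \<open>e > 0\<close> by fastforce
    qed
  qed
  show ?thesis
  proof (intro equalityI subsetI)
    fix x assume "x \<in> S"
    then show "x \<in> {Inf S<..<Sup S}"
      using no cInf_lower[OF _ bdd(1)] cSup_upper[OF _ bdd(2)]
      by (metis greaterThanLessThan_iff order_less_le)
  next
    fix x assume "x \<in> {Inf S<..<Sup S}"
    then obtain a b where "a \<in> S" "a < x" "b \<in> S" "x < b"
      using assms(4) bdd by (auto simp: cInf_less_iff less_cSup_iff)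
    then show "x \<in> S"
      using assms(3) by (meson connectedD_interval less_imp_le)
  qed
qed

text \<open>
  A full line is not a disjoint union of two closed half-lines, so horizontal rays can only fill
  the heights met by \<open>\<Omega>\<close>; the two remaining closed half-planes are filled by vertical rays.
\<close>
lemma horizontally_convex_imp_close_to_convex_domain:
  assumes op: "open \<Omega>" and bd: "bounded \<Omega>" and con: "connected \<Omega>" and ne: "\<Omega> \<noteq> {}"
    and hc: "horizontally_convex \<Omega>"
  shows "close_to_convex_domain \<Omega>"
proof -
  define Y where "Y = Im ` \<Omega>"
  define X where "X y = {x. Complex x y \<in> \<Omega>}" for y
  have "open Y" unfolding Y_def 
    by (rule open_surjective_linear_image[OF op])
      (auto simp: bounded_linear.linear[OF bounded_linear_Im] surj_def intro: exI[of _ "Complex 0 _"])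
  moreover have "bounded Y" unfolding Y_def using bd bounded_linear_image bounded_linear_Im by blast
  moreover have "connected Y" unfolding Y_def
    by (intro connected_continuous_image con continuous_intros)
  ultimately have Y: "Y = {Inf Y<..<Sup Y}"
    using ne by (intro bounded_open_connected_real) (auto simp: Y_def)
  have Xne: "X y \<noteq> {}" if y: "y \<in> Y" for y
  proof -
    obtain z where "z \<in> \<Omega>" "y = Im z" using y by (auto simp: Y_def)
    then have "Re z \<in> X y" by (simp add: X_def)
    then show ?thesis by blast
  qed
  have X: "X y = {Inf (X y)<..<Sup (X y)}" if "y \<in> Y" for y
  proof (rule bounded_open_connected_real)
    have "X y = (\<lambda>x. Complex x y) -` \<Omega>" by (auto simp: X_def)
    moreover have "continuous_on UNIV (\<lambda>x. Complex x y)"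
      by (intro continuous_intros)
    ultimately show "open (X y)" using op by (simp add: open_vimage)
    have "X y \<subseteq> Re ` \<Omega>" by (force simp: X_def)
    then show "bounded (X y)"
      using bd bounded_linear_image[OF bd bounded_linear_Re] bounded_subset by blast
    show "connected (X y)"
      unfolding connected_iff_interval X_def mem_Collect_eq
      using hc[unfolded horizontally_convex_def] by blast
    show "X y \<noteq> {}" using that by (rule Xne)
  qed
  \<comment> \<open>The slices \<open>X y\<close> and the set of heights \<open>Y\<close> are open
    intervals, so their endpoints lie outside. What remains are closed rays: horizontal ones at
    heights in \<open>Y\<close>, vertical ones beyond.\<close>
  define R1 where "R1 = (\<lambda>y. {z. Im z = y \<and> Re z \<ge> Sup (X y)}) ` Y"
  define R2 where "R2 = (\<lambda>y. {z. Im z = y \<and> Re z \<le> Inf (X y)}) ` Y"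
  define R3 where "R3 = range (\<lambda>x. {z. Re z = x \<and> Im z \<ge> Sup Y})"
  define R4 where "R4 = range (\<lambda>x. {z. Re z = x \<and> Im z \<le> Inf Y})"
  have Xiff: "x \<in> X y \<longleftrightarrow> Inf (X y) < x \<and> x < Sup (X y)" if "y \<in> Y" for x y
    using arg_cong[OF X[OF that], of "\<lambda>A. x \<in> A"] by simp
  have Yiff: "y \<in> Y \<longleftrightarrow> Inf Y < y \<and> y < Sup Y" for y
    using arg_cong[OF Y, of "\<lambda>A. y \<in> A"] by simp
  have Inf_less: "Inf (X y) < Sup (X y)" if "y \<in> Y" for y
    using Xne[OF that] Xiff[OF that] by (meson all_not_in_conv less_trans)
  have "Y \<noteq> {}" using ne by (simp add: Y_def)
  then have YI: "Inf Y < Sup Y"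
    using Yiff by (meson all_not_in_conv less_trans)
  have Om: "z \<in> \<Omega> \<longleftrightarrow> Im z \<in> Y \<and> Inf (X (Im z)) < Re z \<and> Re z < Sup (X (Im z))" for z
  proof -
    have "z \<in> \<Omega> \<longleftrightarrow> Re z \<in> X (Im z)" by (simp add: X_def)
    moreover have "z \<in> \<Omega> \<Longrightarrow> Im z \<in> Y" by (simp add: Y_def)
    ultimately show ?thesis using Xiff by blast
  qed
  show ?thesis
    unfolding close_to_convex_domain_def
  proof (intro exI conjI ballI)
    show "half_line L" if "L \<in> (R1 \<union> R2) \<union> (R3 \<union> R4)" for L
      using that half_line_right half_line_left half_line_up half_line_down
      by (auto simp: R1_def R2_def R3_def R4_def)
    show "\<Union>((R1 \<union> R2) \<union> (R3 \<union> R4)) = - \<Omega>"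
      by (auto simp: R1_def R2_def R3_def R4_def Om Yiff not_less)
    show "pairwise disjnt ((R1 \<union> R2) \<union> (R3 \<union> R4))"
    proof (rule pairwiseI)
      fix L M assume L: "L \<in> (R1 \<union> R2) \<union> (R3 \<union> R4)" and M: "M \<in> (R1 \<union> R2) \<union> (R3 \<union> R4)" and ne: "L \<noteq> M"
      show "disjnt L M"
      proof (rule ccontr)
        assume "\<not> disjnt L M"
        then obtain z where "z \<in> L" "z \<in> M" by (auto simp: disjnt_iff)
        with L M ne show False
          using Inf_less[of "Im z"] YI by (auto simp: R1_def R2_def R3_def R4_def Yiff)
      qed
    qed
  qed
qed

section \<open>Analytic functions convex in one direction\<close>

text \<open>The squared moduli of denominator and numerator differ by
  \<open>4 * sin \<gamma> * Im w\<close>, so the upper half-plane goes into the disc. The map sends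
  0 to \<open>cis (- \<gamma>)\<close> and infinity to \<open>cis \<gamma>\<close>.\<close>

lemma moebius_half_plane_disc:
  assumes \<gamma>: "0 < \<gamma>" "\<gamma> < pi" and w: "Im w > 0"
  shows "1 + cis (- \<gamma>) * w \<noteq> 0"
    and "(cis (- \<gamma>) + w) / (1 + cis (- \<gamma>) * w) \<in> ball 0 1"
proof -
  have s: "sin \<gamma> > 0" using \<gamma> sin_gt_zero by blast
  have "(cmod (1 + cis (- \<gamma>) * w))\<^sup>2 - (cmod (cis (- \<gamma>) + w))\<^sup>2 = 4 * sin \<gamma> * Im w"
  proof -
    \<comment> \<open>Displaying the vanishing Pythagorean factor turns the claim into a polynomial
      identity.\<close>
    have "(cmod (1 + cis (- \<gamma>) * w))\<^sup>2 - (cmod (cis (- \<gamma>) + w))\<^sup>2 - 4 * sin \<gamma> * Im w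
      = (1 - (sin \<gamma>)\<^sup>2 - (cos \<gamma>)\<^sup>2) * (1 - (Re w)\<^sup>2 - (Im w)\<^sup>2)"
      unfolding cmod_power2 by (simp add: power2_eq_square) algebra
    also have "1 - (sin \<gamma>)\<^sup>2 - (cos \<gamma>)\<^sup>2 = 0" using sin_cos_squared_add[of \<gamma>] by linarith
    finally show ?thesis by simp
  qed
  also have "\<dots> > 0" using s w by simp
  finally have lt: "(cmod (cis (- \<gamma>) + w))\<^sup>2 < (cmod (1 + cis (- \<gamma>) * w))\<^sup>2" by simp
  then show nz: "1 + cis (- \<gamma>) * w \<noteq> 0" by (metis norm_zero not_less zero_eq_power2 zero_le_power2)
  have "cmod (cis (- \<gamma>) + w) < cmod (1 + cis (- \<gamma>) * w)"
    using lt by (simp add: power2_less_imp_less)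
  then show "(cis (- \<gamma>) + w) / (1 + cis (- \<gamma>) * w) \<in> ball 0 1"
    using nz by (simp add: norm_divide)
qed

text \<open>The inverse map is \<open>(z - e) / (1 - e * z)\<close>. Multiplied by the squared
  modulus of the denominator, its imaginary part is sin \<gamma> times 1 minus the squared modulus
  of \<open>z\<close>.\<close>

lemma moebius_disc_half_plane:
  assumes \<gamma>: "0 < \<gamma>" "\<gamma> < pi" and z: "z \<in> ball 0 1"
  obtains w where "Im w > 0" "z = (cis (- \<gamma>) + w) / (1 + cis (- \<gamma>) * w)"
proof -
  define e where "e = cis (- \<gamma>)"
  define w where "w = (z - e) / (1 - e * z)"
  have s: "sin \<gamma> > 0" using \<gamma> sin_gt_zero by blast
  have ne: "norm e = 1" by (simp add: e_def)
  have z1: "cmod z < 1" using z by simp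
  have nz: "1 - e * z \<noteq> 0"
  proof
    assume "1 - e * z = 0"
    then have "norm (e * z) = 1" by (metis eq_iff_diff_eq_0 norm_one)
    then show False using z1 by (simp add: norm_mult ne)
  qed
  have "(cmod z)\<^sup>2 < 1" using z1 by (simp add: power_less_one_iff)
  then have z2: "(Re z)\<^sup>2 + (Im z)\<^sup>2 < 1" by (simp add: cmod_power2)
  have "Im ((z - e) * cnj (1 - e * z)) = sin \<gamma> * (1 - ((Re z)\<^sup>2 + (Im z)\<^sup>2))"
  proof -
    have "Im ((z - e) * cnj (1 - e * z)) - sin \<gamma> * (1 - ((Re z)\<^sup>2 + (Im z)\<^sup>2))
      = Im z * ((sin \<gamma>)\<^sup>2 + (cos \<gamma>)\<^sup>2 - 1) * (-1)"
      by (simp add: e_def power2_eq_square) algebra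
    also have "(sin \<gamma>)\<^sup>2 + (cos \<gamma>)\<^sup>2 - 1 = 0" using sin_cos_squared_add[of \<gamma>] by linarith
    finally show ?thesis by simp
  qed
  then have pos: "Im ((z - e) * cnj (1 - e * z)) > 0" using s z2 by simp
  have w': "w = (z - e) * cnj (1 - e * z) / of_real ((cmod (1 - e * z))\<^sup>2)"
    unfolding w_def by (subst complex_div_cnj) simp
  then have w0: "Im w > 0"
    using pos nz by (simp only: w' Im_divide_of_real) (simp add: zero_less_divide_iff)
  have "1 + e * w \<noteq> 0" using moebius_half_plane_disc(1)[OF \<gamma> w0] by (simp add: e_def)
  moreover have "w * (1 - e * z) = z - e" using nz by (simp add: w_def)
  then have "z * (1 + e * w) = e + w" by (simp add: algebra_simps)
  ultimately have "z = (e + w) / (1 + e * w)" by (simp add: field_simps)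
  with w0 show thesis using that by (simp add: e_def)
qed

text \<open>The Noshiro-Warschawski argument: along the segment the imaginary part of
  \<open>G / d\<close> has derivative \<open>Im G'\<close>. In the strip it yields both injectivity
  and growth of the imaginary part along horizontal lines.\<close>

lemma Im_increment_pos:
  assumes S: "convex S" and G: "\<And>z. z \<in> S \<Longrightarrow> (G has_field_derivative G' z) (at z)"
    and pos: "\<And>z. z \<in> S \<Longrightarrow> Im (G' z) > 0"
    and z: "z \<in> S" "z + d \<in> S" "d \<noteq> 0"
  shows "Im ((G (z + d) - G z) / d) > 0"
proof -
  define p where "p t = Im (G (z + of_real t * d) / d)" for t
  have "p 0 < p 1"
  proof (rule DERIV_pos_imp_increasing[where f=p])
    fix t :: real assume t: "0 \<le> t" "t \<le> 1"
    have "(1 - t) *\<^sub>R z + t *\<^sub>R (z + d) \<in> S" using t z S by (intro convexD) auto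
    then have inS: "z + of_real t * d \<in> S" by (simp add: scaleR_conv_of_real algebra_simps)
    have "((\<lambda>t. G (z + of_real t * d)) has_vector_derivative (d * G' (z + of_real t * d))) (at t)"
    proof -
      have "((\<lambda>t. z + of_real t * d) has_vector_derivative d) (at t)"
        by (auto intro!: derivative_eq_intros)
      from field_vector_diff_chain_at[OF this G[OF inS]] show ?thesis by (simp add: o_def)
    qed
    then have "((\<lambda>t. G (z + of_real t * d) / d) has_vector_derivative (d * G' (z + of_real t * d)) / d) (at t)"
      by (rule has_vector_derivative_divide)
    then have "(p has_real_derivative Im ((d * G' (z + of_real t * d)) / d)) (at t)"
      unfolding p_def by (rule has_field_derivative_Im)
    then show "\<exists>y. (p has_real_derivative y) (at t) \<and> 0 < y"
      using pos[OF inS] z(3) by auto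
  qed simp
  then show ?thesis by (simp add: p_def diff_divide_distrib)
qed

text \<open>
  The factor \<open>z\<^sup>2 - 2 z cos \<gamma> + 1\<close> comes from the conformal map of the strip \<open>0 < Im \<zeta> < \<pi>\<close> onto
  the disc that sends the two ends of the strip to \<open>e\<^sup>-\<^sup>i\<^sup>\<gamma>\<close> and \<open>e\<^sup>i\<^sup>\<gamma>\<close>. In this coordinate \<open>Im F\<close> increases
  along horizontal lines from \<open>Im F(e\<^sup>-\<^sup>i\<^sup>\<gamma>)\<close> to \<open>Im F(e\<^sup>i\<^sup>\<gamma>)\<close>, so its level sets are graphs over the
  vertical variable, hence connected.
\<close>
lemma convex_in_one_direction:
  assumes holF: "F holomorphic_on ball 0 1" and contF: "continuous_on (cball 0 1) F"
    and \<gamma>: "0 < \<gamma>" "\<gamma> < pi"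
    and pos: "\<And>z. z \<in> ball 0 1 \<Longrightarrow> Re (deriv F z * (z\<^sup>2 - 2 * of_real (cos \<gamma>) * z + 1)) > 0"
  shows "inj_on F (ball 0 1)" and "horizontally_convex (F ` ball 0 1)"
proof -
  define e where "e = cis (- \<gamma>)"
  have ee: "e * cnj e = 1" "cnj e = cis \<gamma>" "norm e = 1" "e \<noteq> 0"
    by (auto simp: e_def cis_cnj cis_mult)
  have s0: "sin \<gamma> > 0" using \<gamma> sin_gt_zero by blast
  have eci: "e - cnj e = - 2 * \<i> * sin \<gamma>" by (simp add: e_def complex_eq_iff)
  define m where "m w = (e + w) / (1 + e * w)" for w
  have m: "1 + e * w \<noteq> 0" "m w \<in> ball 0 1" if "Im w > 0" for w
    using moebius_half_plane_disc[OF \<gamma> that] by (auto simp: m_def e_def)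
  define S where "S = {z. 0 < Im z \<and> Im z < pi}"
  have S: "convex S"
  proof -
    have "S = {z. Im z > 0} \<inter> {z. Im z < pi}" by (auto simp: S_def)
    then show ?thesis
      by (auto intro!: convex_Int convex_halfspace_Im_gt convex_halfspace_Im_lt)
  qed
  have ImS: "Im (exp z) > 0" if "z \<in> S" for z
    using that by (auto simp: S_def Im_exp sin_gt_zero)
  define Z where "Z z = m (exp z)" for z
  have ZD: "Z z \<in> ball 0 1" if "z \<in> S" for z using m(2)[OF ImS[OF that]] by (simp add: Z_def)
  have Zsurj: "\<exists>\<zeta>\<in>S. Z \<zeta> = z" if z: "z \<in> ball 0 1" for z
  proof -
    obtain w where w: "Im w > 0" "z = m w"
      using moebius_disc_half_plane[OF \<gamma> z] by (auto simp: m_def e_def)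
    then have "w \<noteq> 0" by auto
    moreover have "Ln w \<in> S" using w Im_Ln_pos_lt[OF \<open>w \<noteq> 0\<close>] by (simp add: S_def)
    ultimately show ?thesis using w by (intro bexI[of _ "Ln w"]) (auto simp: Z_def)
  qed
  define G where "G z = F (Z z)" for z
  \<comment> \<open>The derivative of \<open>Z\<close> is i / (2 sin \<gamma>) times the quadratic
    in \<open>Z\<close>, so the hypothesis on a real part becomes
    \<open>Im (G' z) > 0\<close>.\<close>
  define G' where "G' z = \<i> / (2 * sin \<gamma>) * (deriv F (Z z) * ((Z z)\<^sup>2 - 2 * of_real (cos \<gamma>) * Z z + 1))" for z
  have derG: "(G has_field_derivative G' z) (at z)" if z: "z \<in> S" for z
  proof -
    let ?w = "exp z"
    have nz: "1 + e * ?w \<noteq> 0" using m(1)[OF ImS[OF z]] .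
    have "(Z has_field_derivative (?w * (1 + e * ?w) - (e + ?w) * (e * ?w)) / ((1 + e * ?w) * (1 + e * ?w))) (at z)"
      unfolding Z_def m_def using nz by (auto intro!: derivative_eq_intros)
    moreover have "(F has_field_derivative deriv F (Z z)) (at (Z z))"
      using holF ZD[OF z] by (meson holomorphic_derivI open_ball)
    ultimately have "((\<lambda>z. F (Z z)) has_field_derivative
        deriv F (Z z) * ((?w * (1 + e * ?w) - (e + ?w) * (e * ?w)) / ((1 + e * ?w) * (1 + e * ?w)))) (at z)"
      by (rule DERIV_chain2[rotated])
    moreover have "(?w * (1 + e * ?w) - (e + ?w) * (e * ?w)) / ((1 + e * ?w) * (1 + e * ?w))
        = \<i> / (2 * sin \<gamma>) * ((Z z)\<^sup>2 - 2 * of_real (cos \<gamma>) * Z z + 1)"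
    proof -
      have c2: "2 * of_real (cos \<gamma>) = e + cnj e" by (simp add: e_def complex_eq_iff)
      have "(Z z)\<^sup>2 - 2 * of_real (cos \<gamma>) * Z z + 1 = (Z z - e) * (Z z - cnj e)"
        unfolding c2 using ee(1) by (simp add: algebra_simps power2_eq_square)
      also have "Z z - e = ?w * (1 - e * e) / (1 + e * ?w)"
        using nz by (simp add: Z_def m_def field_simps)
      also have "Z z - cnj e = (e - cnj e) / (1 + e * ?w)"
      proof -
        have num: "e + ?w - cnj e * (1 + e * ?w) = e - cnj e"
          using ee(1) by algebra
        have "Z z - cnj e = (e + ?w - cnj e * (1 + e * ?w)) / (1 + e * ?w)"
          using nz unfolding diff_divide_distrib[of "e + ?w"] by (simp add: Z_def m_def)
        then show ?thesis unfolding num .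
      qed
      finally have Q: "(Z z)\<^sup>2 - 2 * of_real (cos \<gamma>) * Z z + 1
         = ?w * (1 - e * e) / (1 + e * ?w) * ((- 2 * \<i> * sin \<gamma>) / (1 + e * ?w))" unfolding eci .
      have I: "\<i> / (2 * sin \<gamma>) * (- 2 * \<i> * sin \<gamma>) = 1" using s0 by (simp add: field_simps)
      have gen: "A * (x / D * (B / D)) = (A * B) * x / (D * D)" for A B x D :: complex by simp
      have "?w * (1 - e * e) = ?w * (1 + e * ?w) - (e + ?w) * (e * ?w)"
        by (simp add: algebra_simps)
      then show ?thesis unfolding Q gen I by simp
    qed
    ultimately have "((\<lambda>z. F (Z z)) has_field_derivative
        deriv F (Z z) * (\<i> / (2 * sin \<gamma>) * ((Z z)\<^sup>2 - 2 * of_real (cos \<gamma>) * Z z + 1))) (at z)"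
      by (simp only:)
    then show ?thesis unfolding G_def G'_def by (simp only: mult_ac)
  qed
  have G'pos: "Im (G' z) > 0" if "z \<in> S" for z
  proof -
    have gen: "Im (\<i> / (2 * of_real c) * q) = Re q / (2 * c)" for c q
      using Im_divide_of_real[of "\<i> * q" "2 * c"] by simp
    show ?thesis unfolding G'_def gen using pos[OF ZD[OF that]] s0 by simp
  qed
  note incr = Im_increment_pos[OF S derG G'pos]
  show "inj_on F (ball 0 1)"
  proof (rule inj_onI, rule ccontr)
    fix x y assume xy: "x \<in> ball 0 1" "y \<in> ball 0 1" "F x = F y" "x \<noteq> y"
    obtain a b where "a \<in> S" "Z a = x" "b \<in> S" "Z b = y" using Zsurj xy by metis
    then show False using incr[of a "b - a"] xy by (auto simp: G_def)
  qed
  have mono: "Im (G (Complex t s)) < Im (G (Complex t' s))" if "0 < s" "s < pi" "t < t'" for s t t'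
  proof -
    have eq: "Complex t s + of_real (t' - t) = Complex t' s" by (simp add: complex_eq_iff)
    have "Im ((G (Complex t s + of_real (t' - t)) - G (Complex t s)) / of_real (t' - t)) > 0"
      using that by (intro incr) (simp_all only: eq, auto simp: S_def)
    then show ?thesis using that unfolding eq Im_divide_of_real by (simp add: zero_less_divide_iff)
  qed
  have expt: "exp (Complex t s) = of_real (exp t) * cis s" for t s
    by (simp add: exp_eq_polar)
  have lim_bot: "((\<lambda>t. Im (G (Complex t s))) \<longlongrightarrow> Im (F e)) at_bot" if s: "0 < s" "s < pi" for s
  proof -
    have "((\<lambda>t. of_real (exp t) * cis s) \<longlongrightarrow> of_real 0 * cis s) at_bot"
      by (intro tendsto_intros exp_at_bot)
    then have "((\<lambda>t. Z (Complex t s)) \<longlongrightarrow> (e + 0) / (1 + e * 0)) at_bot"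
      unfolding Z_def m_def expt by (intro tendsto_intros) auto
    then have "((\<lambda>t. F (Z (Complex t s))) \<longlongrightarrow> F e) at_bot"
      by (intro continuous_on_tendsto_compose[OF contF])
        (use ee ZD s in \<open>auto simp: S_def intro!: always_eventually less_imp_le\<close>)
    then show ?thesis unfolding G_def by (rule tendsto_Im)
  qed
  have lim_top: "((\<lambda>t. Im (G (Complex t s))) \<longlongrightarrow> Im (F (cnj e))) at_top" if s: "0 < s" "s < pi" for s
  proof -
    \<comment> \<open>At this end \<open>exp\<close> is unbounded. The quotient is rewritten in the
      reciprocal of the exponential, which tends to 0, and the limit is 1 / \<open>e\<close>, that
      is \<open>cnj e\<close>.\<close>
    have "((\<lambda>t. of_real (exp (- t)) * cis (- s)) \<longlongrightarrow> of_real 0 * cis (- s)) at_top"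
      by (intro tendsto_intros filterlim_compose[OF exp_at_bot filterlim_uminus_at_bot_at_top])
    then have "((\<lambda>t. (e * (of_real (exp (- t)) * cis (- s)) + 1) / (of_real (exp (- t)) * cis (- s) + e))
        \<longlongrightarrow> (e * 0 + 1) / (0 + e)) at_top"
      using ee by (intro tendsto_intros) auto
    moreover have "(e * (of_real (exp (- t)) * cis (- s)) + 1) / (of_real (exp (- t)) * cis (- s) + e) = Z (Complex t s)" for t
    proof -
      define v where "v = of_real (exp (- t)) * cis (- s)"
      have v: "v * exp (Complex t s) = 1"
        by (simp add: v_def expt cis_mult flip: of_real_mult exp_add)
          (simp add: cis_mult mult.left_commute mult.assoc flip: of_real_mult exp_add)
      then have v0: "v \<noteq> 0" by auto
      have "Z (Complex t s) = (v * (e + exp (Complex t s))) / (v * (1 + e * exp (Complex t s)))"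
        using v0 by (simp add: Z_def m_def)
      also have "\<dots> = (e * v + 1) / (v + e)" using v by (simp add: algebra_simps)
      finally show ?thesis by (simp add: v_def)
    qed
    moreover have "(e * 0 + 1) / (0 + e) = cnj e" using ee by (simp add: field_simps)
    ultimately have "((\<lambda>t. Z (Complex t s)) \<longlongrightarrow> cnj e) at_top" by simp
    then have "((\<lambda>t. F (Z (Complex t s))) \<longlongrightarrow> F (cnj e)) at_top"
      by (intro continuous_on_tendsto_compose[OF contF])
        (use ee ZD s in \<open>auto simp: S_def intro!: always_eventually less_imp_le\<close>)
    then show ?thesis unfolding G_def by (rule tendsto_Im)
  qed
  \<comment> \<open>The limits give only weak bounds; comparison with the point one unit further out
    makes them strict.\<close>
  have range: "Im (F e) < Im (G (Complex t s))" "Im (G (Complex t s)) < Im (F (cnj e))"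
    if s: "0 < s" "s < pi" for s t
  proof -
    have "Im (F e) \<le> Im (G (Complex (t - 1) s))"
      by (rule tendsto_upperbound[OF lim_bot[OF s]])
        (auto simp: eventually_at_bot_linorder intro!: exI[of _ "t - 2"] less_imp_le mono s)
    also have "\<dots> < Im (G (Complex t s))" using mono s by simp
    finally show "Im (F e) < Im (G (Complex t s))" .
    have "Im (G (Complex t s)) < Im (G (Complex (t + 1) s))" using mono s by simp
    also have "\<dots> \<le> Im (F (cnj e))"
      by (rule tendsto_lowerbound[OF lim_top[OF s]])
        (auto simp: eventually_at_top_linorder intro!: exI[of _ "t + 2"] less_imp_le mono s)
    finally show "Im (G (Complex t s)) < Im (F (cnj e))" .
  qed
  have contG: "continuous_on S G"
    using derG by (meson DERIV_isCont continuous_at_imp_continuous_on)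
  have ex: "\<exists>t. Im (G (Complex t s)) = y"
    if s: "0 < s" "s < pi" and y: "Im (F e) < y" "y < Im (F (cnj e))" for s y
  proof -
    obtain t1 where t1: "Im (G (Complex t1 s)) < y"
      using order_tendstoD(2)[OF lim_bot[OF s] y(1)] by (auto simp: eventually_at_bot_linorder)
    obtain t2 where t2: "y < Im (G (Complex t2 s))"
      using order_tendstoD(1)[OF lim_top[OF s] y(2)] by (auto simp: eventually_at_top_linorder)
    have "continuous_on A (\<lambda>t. Im (G (Complex t s)))" for A
      by (intro continuous_intros continuous_on_compose2[OF contG]) (use s in \<open>auto simp: S_def\<close>)
    moreover have "t1 \<le> t2" using mono[OF s, of t2 t1] t1 t2 by (meson less_trans not_le not_less_iff_gr_or_eq)
    ultimately show ?thesis using IVT'[of "\<lambda>t. Im (G (Complex t s))" t1 y t2] t1 t2 by auto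
  qed
  show "horizontally_convex (F ` ball 0 1)"
    unfolding horizontally_convex_def
  proof (intro allI impI)
    fix x1 x x2 y assume A: "Complex x1 y \<in> F ` ball 0 1" "Complex x2 y \<in> F ` ball 0 1" "x1 \<le> x" "x \<le> x2"
    obtain a where a: "a \<in> S" "G a = Complex x1 y"
      using A(1) Zsurj unfolding G_def by (metis (no_types, opaque_lifting) imageE)
    obtain b where b: "b \<in> S" "G b = Complex x2 y"
      using A(2) Zsurj unfolding G_def by (metis (no_types, opaque_lifting) imageE)
    have y: "Im (F e) < y" "y < Im (F (cnj e))"
      using range[of "Im a" "Re a"] a by (auto simp: S_def)
    \<comment> \<open>\<open>T\<close> parametrises the level line of \<open>Im G\<close> at
      \<open>y\<close> by the height \<open>s\<close> in the strip. Strict monotonicity makes the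
      chosen value the only one, as \<open>uniq\<close> records.\<close>
    define T where "T s = (SOME t. Im (G (Complex t s)) = y)" for s
    have T: "Im (G (Complex (T s) s)) = y" if "0 < s" "s < pi" for s
      unfolding T_def by (rule someI_ex[OF ex[OF that y]])
    have uniq: "T (Im c) = Re c" if "c \<in> S" "Im (G c) = y" for c
    proof -
      have c: "0 < Im c" "Im c < pi" using that by (auto simp: S_def)
      have "Im (G (Complex (Re c) (Im c))) = y" using that(2) by simp
      then have "\<not> T (Im c) < Re c" "\<not> Re c < T (Im c)"
        using T[OF c] mono[OF c, of "T (Im c)" "Re c"] mono[OF c, of "Re c" "T (Im c)"] by linarith+
      then show ?thesis by linarith
    qed
    have contT: "continuous_on {0<..<pi} T"
    proof (subst continuous_on_eq_continuous_at[OF open_greaterThanLessThan], intro ballI)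
      fix s0 assume s0: "s0 \<in> {0<..<pi}"
      have cont: "isCont (\<lambda>s. Im (G (Complex t s))) s0" for t
      proof -
        have "continuous_on {0<..<pi} (\<lambda>s. Im (G (Complex t s)))"
          by (intro continuous_intros continuous_on_compose2[OF contG]) (auto simp: S_def)
        then show ?thesis using s0 by (simp add: continuous_on_eq_continuous_at)
      qed
      have ev0: "\<forall>\<^sub>F s in at s0. s \<in> {0<..<pi}"
        using s0 by (intro eventually_at_in_open') auto
      show "isCont T s0"
        unfolding isCont_def
      proof (rule tendstoI)
        fix \<epsilon> :: real assume \<epsilon>: "\<epsilon> > 0"
        \<comment> \<open>These strict inequalities persist for nearby \<open>s\<close>, and
          monotonicity in \<open>t\<close> then traps \<open>T s\<close> within \<epsilon> of
          \<open>T s0\<close>.\<close>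
        have "Im (G (Complex (T s0 - \<epsilon>) s0)) < y" "y < Im (G (Complex (T s0 + \<epsilon>) s0))"
          using mono[of s0 "T s0 - \<epsilon>" "T s0"] mono[of s0 "T s0" "T s0 + \<epsilon>"] T[of s0] s0 \<epsilon> by auto
        then have "\<forall>\<^sub>F s in at s0. Im (G (Complex (T s0 - \<epsilon>) s)) < y"
          "\<forall>\<^sub>F s in at s0. y < Im (G (Complex (T s0 + \<epsilon>) s))"
          using cont[of "T s0 - \<epsilon>"] cont[of "T s0 + \<epsilon>"] unfolding isCont_def
          by (auto intro: order_tendstoD)
        then show "\<forall>\<^sub>F s in at s0. dist (T s) (T s0) < \<epsilon>"
          using ev0
        proof eventually_elim
          case (elim s)
          have "\<not> T s \<le> T s0 - \<epsilon>" "\<not> T s0 + \<epsilon> \<le> T s"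
            using elim T[of s] mono[of s "T s" "T s0 - \<epsilon>"] mono[of s "T s0 + \<epsilon>" "T s"]
            by (auto simp: le_less)
          then show ?case by (auto simp: dist_real_def)
        qed
      qed
    qed
    \<comment> \<open>The level line is a connected curve, so the real parts along its image form an
      interval, which contains \<open>x1\<close> and \<open>x2\<close>.\<close>
    have "connected ((\<lambda>s. Re (G (Complex (T s) s))) ` {0<..<pi})"
    proof (rule connected_continuous_image)
      show "continuous_on {0<..<pi} (\<lambda>s. Re (G (Complex (T s) s)))"
        by (intro continuous_intros continuous_on_compose2[OF contG] contT) (auto simp: S_def)
    qed auto
    moreover have "x1 \<in> (\<lambda>s. Re (G (Complex (T s) s))) ` {0<..<pi}"
      using uniq[OF a(1)] a by (intro image_eqI[of _ _ "Im a"]) (auto simp: S_def)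
    moreover have "x2 \<in> (\<lambda>s. Re (G (Complex (T s) s))) ` {0<..<pi}"
      using uniq[OF b(1)] b by (intro image_eqI[of _ _ "Im b"]) (auto simp: S_def)
    ultimately have "x \<in> (\<lambda>s. Re (G (Complex (T s) s))) ` {0<..<pi}"
      using A(3,4) by (meson connectedD_interval)
    then obtain s where s: "0 < s" "s < pi" "x = Re (G (Complex (T s) s))" by auto
    then have "Complex x y = F (Z (Complex (T s) s))"
      using T[of s] by (simp add: complex_eq_iff G_def)
    then show "Complex x y \<in> F ` ball 0 1"
      using ZD[of "Complex (T s) s"] s by (auto simp: S_def)
  qed
qed

text \<open>The shear construction of Clunie and Sheil-Small.\<close>
lemma horizontal_shear:
  assumes hol: "F holomorphic_on D" "F2 holomorphic_on D" and D: "open D"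
    and inj: "inj_on F D" and hc: "horizontally_convex (F ` D)"
    and P: "\<And>z. z \<in> D \<Longrightarrow> deriv F2 z = P z * deriv F z" "\<And>z. z \<in> D \<Longrightarrow> Re (P z) > 0"
  shows "inj_on (\<lambda>z. Complex (Re (F2 z)) (Im (F z))) D"
    and "horizontally_convex ((\<lambda>z. Complex (Re (F2 z)) (Im (F z))) ` D)"
proof -
  obtain k where k: "k holomorphic_on F ` D" "\<And>z. z \<in> D \<Longrightarrow> deriv F z * deriv k (F z) = 1"
    "\<And>z. z \<in> D \<Longrightarrow> k (F z) = z"
    using holomorphic_has_inverse[OF hol(1) D inj] by blast
  have op: "open (F ` D)" using open_mapping_thm3[OF hol(1) D inj] .
  \<comment> \<open>On the slice at height \<open>y\<close>, \<open>r y\<close> expresses the real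
    part of \<open>F2\<close> through that of \<open>F\<close>. The composite of \<open>F2\<close>
    with the inverse \<open>k\<close> has derivative \<open>P\<close>, so \<open>r y\<close> has
    positive slope.\<close>
  define r where "r y x = Re (F2 (k (Complex x y)))" for x y
  have r: "r (Im (F z)) (Re (F z)) = Re (F2 z)" if "z \<in> D" for z
    using k(3)[OF that] by (simp add: r_def)
  have derr: "\<exists>d. (r y has_real_derivative d) (at x) \<and> 0 < d" if xy: "Complex x y \<in> F ` D" for x y
  proof -
    obtain z where z: "z \<in> D" "Complex x y = F z" using xy by auto
    have kz: "k (Complex x y) = z" using k z by simp
    have "(k has_field_derivative deriv k (F z)) (at (F z))"
      using k(1) op z by (meson holomorphic_derivI imageI)
    moreover have "(F2 has_field_derivative deriv F2 z) (at (k (F z)))"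
      using hol(2) D z k(3) by (metis holomorphic_derivI)
    ultimately have d: "((\<lambda>w. F2 (k w)) has_field_derivative deriv F2 z * deriv k (F z)) (at (Complex x y))"
      unfolding z(2) by (rule DERIV_chain2[rotated])
    have "deriv F2 z * deriv k (F z) = P z" using P(1)[OF z(1)] k(2)[OF z(1)] by (simp add: mult.assoc)
    note d = d[unfolded this]
    have "((\<lambda>x. Complex x y) has_vector_derivative 1) (at x)"
      unfolding Complex_eq by (auto intro!: derivative_eq_intros)
    from field_vector_diff_chain_at[OF this d]
    have "((\<lambda>x. F2 (k (Complex x y))) has_vector_derivative P z) (at x)" by (simp add: o_def)
    then have "(r y has_real_derivative Re (P z)) (at x)"
      unfolding r_def by (rule has_field_derivative_Re)
    then show ?thesis using P(2) z by blast
  qed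
  have seg: "Complex x (Im (F b)) \<in> F ` D"
    if "a \<in> D" "b \<in> D" "Im (F a) = Im (F b)" "Re (F a) \<le> x" "x \<le> Re (F b)" for a b x
    using hc that unfolding horizontally_convex_def by (metis complex_surj imageI)
  \<comment> \<open>Horizontal convexity keeps the whole segment from \<open>F a\<close> to
    \<open>F b\<close> in the image, so the sign of the slope is available all along it.\<close>
  have mono: "Re (F2 a) < Re (F2 b)"
    if ab: "a \<in> D" "b \<in> D" "Im (F a) = Im (F b)" "Re (F a) < Re (F b)" for a b
  proof -
    have "r (Im (F b)) (Re (F a)) < r (Im (F b)) (Re (F b))"
      by (rule DERIV_pos_imp_increasing[where f="r (Im (F b))", OF ab(4)]) (use derr seg ab in blast)
    then show ?thesis using r[of a] r[of b] ab by simp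
  qed
  show "inj_on (\<lambda>z. Complex (Re (F2 z)) (Im (F z))) D"
  proof (rule inj_onI)
    fix a b assume ab: "a \<in> D" "b \<in> D" "Complex (Re (F2 a)) (Im (F a)) = Complex (Re (F2 b)) (Im (F b))"
    then have "Re (F a) = Re (F b)"
      using mono[of a b] mono[of b a] by (cases "Re (F a)" "Re (F b)" rule: linorder_cases) auto
    then have "F a = F b" using ab by (simp add: complex_eq_iff)
    then show "a = b" using inj ab by (meson inj_onD)
  qed
  show "horizontally_convex ((\<lambda>z. Complex (Re (F2 z)) (Im (F z))) ` D)"
    unfolding horizontally_convex_def
  proof (intro allI impI)
    fix x1 x x2 y
    assume "Complex x1 y \<in> (\<lambda>z. Complex (Re (F2 z)) (Im (F z))) ` D"
      and "Complex x2 y \<in> (\<lambda>z. Complex (Re (F2 z)) (Im (F z))) ` D" and x: "x1 \<le> x" "x \<le> x2"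
    then obtain a b where a: "a \<in> D" "x1 = Re (F2 a)" "y = Im (F a)"
      and b: "b \<in> D" "x2 = Re (F2 b)" "y = Im (F b)" by auto
    have le: "Re (F a) \<le> Re (F b)"
      by (rule ccontr) (use mono[of b a] a b x in auto)
    have cont: "continuous_on {Re (F a)..Re (F b)} (r y)"
    proof (rule continuous_at_imp_continuous_on, rule ballI)
      fix t assume "t \<in> {Re (F a)..Re (F b)}"
      then have "Complex t y \<in> F ` D" using seg[of a b t] a b by auto
      then show "isCont (r y) t" using derr DERIV_isCont by blast
    qed
    have ra: "r y (Re (F a)) = x1" "r y (Re (F b)) = x2" using r[of a] r[of b] a b by auto
    obtain t where t: "Re (F a) \<le> t" "t \<le> Re (F b)" "r y t = x"
      using IVT'[of "r y" "Re (F a)" x "Re (F b)", OF _ _ le cont] ra x by auto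
    then obtain z where z: "z \<in> D" "Complex t y = F z" using seg[of a b t] a b by auto
    then have "Re (F z) = t" "Im (F z) = y" by (metis complex.sel)+
    then have "Re (F2 z) = x" using r[OF z(1)] t by simp
    then show "Complex x y \<in> (\<lambda>z. Complex (Re (F2 z)) (Im (F z))) ` D"
      using z \<open>Im (F z) = y\<close> by force
  qed
qed

section \<open>From signs on a circle to convexity in one direction\<close>

lemma has_vector_derivative_cis:
  assumes "(f has_real_derivative d) (at x)"
  shows "((\<lambda>x. cis (f x)) has_vector_derivative of_real d * (\<i> * cis (f x))) (at x)"
  using has_derivative_cis[OF assms[unfolded has_field_derivative_def]]
  by (simp add: has_vector_derivative_def scaleR_conv_of_real mult_ac)

lemma Re_of_real_mult: "Re (of_real r * z) = r * Re z"
  by simp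

text \<open>The zero at \<open>p\<close> excludes that \<open>Q\<close> is an imaginary constant.\<close>
lemma Re_pos_of_boundary:
  assumes hol: "Q holomorphic_on ball 0 1" and cont: "continuous_on (cball 0 1) Q"
    and bd: "\<And>z. norm z = 1 \<Longrightarrow> Re (Q z) \<ge> 0"
    and p: "norm p = 1" "Q p = 0" and Q0: "Q 0 \<noteq> 0" and z: "z \<in> ball 0 1"
  shows "Re (Q z) > 0"
proof -
  \<comment> \<open>The exponential turns the lower bound on \<open>Re Q\<close> into an upper bound
    on a modulus, so the maximum principle applies.\<close>
  define E where "E z = exp (- Q z)" for z
  have holE: "E holomorphic_on ball 0 1" unfolding E_def by (intro holomorphic_intros hol)
  have contE: "continuous_on (cball 0 1) E" unfolding E_def by (intro continuous_intros cont)
  have nE: "norm (E z) = exp (- Re (Q z))" for z by (simp add: E_def)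
  have le: "norm (E w) \<le> 1" if "w \<in> ball 0 1" for w
  proof (rule maximum_modulus_frontier[of E "ball 0 1"])
    show "E holomorphic_on interior (ball 0 1)" using holE by simp
    show "continuous_on (closure (ball 0 1)) E" using contE by simp
    show "norm (E y) \<le> 1" if "y \<in> frontier (ball 0 1)" for y
      using that bd[of y] by (simp add: nE)
  qed (use that in auto)
  show ?thesis
  proof (rule ccontr)
    assume "\<not> Re (Q z) > 0"
    then have "1 \<le> norm (E z)" by (simp add: nE)
    then have "norm (E w) \<le> norm (E z)" if "w \<in> ball 0 1" for w using le[OF that] by linarith
    then have "E constant_on ball 0 1"
      by (rule maximum_modulus_principle[OF holE open_ball connected_ball open_ball subset_refl z])
    then obtain b where b: "\<And>w. w \<in> ball 0 1 \<Longrightarrow> E w = b" by (auto simp: constant_on_def)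
    have derQ: "deriv Q w = 0" if w: "w \<in> ball 0 1" for w
    proof -
      have dQ: "(Q has_field_derivative deriv Q w) (at w)"
        using hol w by (meson holomorphic_derivI open_ball)
      have "(E has_field_derivative exp (- Q w) * (- deriv Q w)) (at w)"
        unfolding E_def by (auto intro!: derivative_eq_intros dQ)
      moreover have "(E has_field_derivative 0) (at w)"
        by (rule has_field_derivative_transform_within_open[OF DERIV_const[of b] open_ball w]) (simp add: b)
      ultimately have "exp (- Q w) * (- deriv Q w) = 0" by (rule DERIV_unique)
      then show ?thesis by simp
    qed
    have "\<exists>c. \<forall>w\<in>ball 0 1. Q w = c"
      by (rule has_field_derivative_zero_constant[OF convex_ball])
        (metis derQ hol holomorphic_derivI open_ball has_field_derivative_at_within)
    then have Qc: "Q w = Q 0" if "w \<in> ball 0 1" for w using that by (metis centre_in_ball zero_less_one)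
    have "Q p = Q 0"
    proof (rule continuous_constant_on_closure[of "ball 0 1" Q])
      show "continuous_on (closure (ball 0 1)) Q" using cont by simp
      show "Q w = Q 0" if "w \<in> ball 0 1" for w using that by (rule Qc)
      show "p \<in> closure (ball 0 1)" using p(1) by simp
    qed
    then show False using p Q0 by simp
  qed
qed

text \<open>These are the signs of the real factor of the quadratic
  \<open>x\<^sup>2 - 2 * cos \<gamma> * x + 1\<close> on the two arcs into which its roots divide
  the unit circle.\<close>

lemma cos_diff_sign:
  assumes \<gamma>: "0 < \<gamma>" "\<gamma> < pi"
  shows "\<lbrakk>- \<gamma> \<le> \<tau>; \<tau> \<le> \<gamma>\<rbrakk> \<Longrightarrow> cos \<gamma> \<le> cos \<tau>"
    and "\<lbrakk>\<gamma> \<le> \<tau>; \<tau> \<le> 2 * pi - \<gamma>\<rbrakk> \<Longrightarrow> cos \<tau> \<le> cos \<gamma>"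
proof -
  show "cos \<gamma> \<le> cos \<tau>" if "- \<gamma> \<le> \<tau>" "\<tau> \<le> \<gamma>"
    using cos_monotone_0_pi_le[of "\<bar>\<tau>\<bar>" \<gamma>] that \<gamma> by (simp add: abs_le_iff)
  show "cos \<tau> \<le> cos \<gamma>" if \<tau>: "\<gamma> \<le> \<tau>" "\<tau> \<le> 2 * pi - \<gamma>"
  proof (cases "\<tau> \<le> pi")
    case True
    then show ?thesis using cos_monotone_0_pi_le[of \<gamma> \<tau>] \<tau> \<gamma> by simp
  next
    case False
    then have "cos (2 * pi - \<tau>) \<le> cos \<gamma>" using cos_monotone_0_pi_le[of \<gamma> "2 * pi - \<tau>"] \<tau> \<gamma> by simp
    then show ?thesis by (simp add: cos_diff)
  qed
qed

text \<open>Scale the disc to unit size and rotate it so that the angles \<open>s\<close> and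
  \<open>t\<close> become \<open>- \<gamma>\<close> and \<gamma>. On the unit circle the quadratic
  in \<open>Q\<close> equals \<open>2 * (Re y - cos \<gamma>) * y\<close>; this real factor and
  \<open>Re (y * D y)\<close> are both nonnegative on one arc and both nonpositive on the other. So
  \<open>Re Q\<close> is nonnegative on the circle, and positive inside by the minimum
  principle.\<close>

lemma unimodal_boundary_imp_convex_in_one_direction:
  assumes hol: "F holomorphic_on ball 0 1" and nz: "\<And>z. z \<in> ball 0 1 \<Longrightarrow> deriv F z \<noteq> 0"
    and \<rho>: "0 < \<rho>" "\<rho> < 1" and st: "s < t" "t < s + 2 * pi"
    and inc: "\<And>\<theta>. s \<le> \<theta> \<Longrightarrow> \<theta> \<le> t \<Longrightarrow>
      Re (of_real \<rho> * cis \<theta> * deriv F (of_real \<rho> * cis \<theta>)) \<ge> 0"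
    and dec: "\<And>\<theta>. t \<le> \<theta> \<Longrightarrow> \<theta> \<le> s + 2 * pi \<Longrightarrow>
      Re (of_real \<rho> * cis \<theta> * deriv F (of_real \<rho> * cis \<theta>)) \<le> 0"
  shows "inj_on F (ball 0 \<rho>)" and "horizontally_convex (F ` ball 0 \<rho>)"
proof -
  define \<sigma> \<gamma> where "\<sigma> = (s + t) / 2" and "\<gamma> = (t - s) / 2"
  have \<gamma>: "0 < \<gamma>" "\<gamma> < pi" using st by (auto simp: \<gamma>_def)
  define \<kappa> where "\<kappa> = of_real \<rho> * cis \<sigma>"
  have n\<kappa>: "norm \<kappa> = \<rho>" using \<rho> by (simp add: \<kappa>_def norm_mult)
  then have \<kappa>0: "\<kappa> \<noteq> 0" using \<rho> by auto
  define F1 where "F1 x = F (\<kappa> * x)" for x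
  have inball: "\<kappa> * x \<in> ball 0 1" if "norm x \<le> 1" for x
  proof -
    have "\<rho> * norm x \<le> \<rho> * 1" using that \<rho> by (intro mult_left_mono) auto
    then have "\<rho> * norm x < 1" using \<rho> by linarith
    then show ?thesis by (simp add: norm_mult n\<kappa>)
  qed
  define D where "D x = \<kappa> * deriv F (\<kappa> * x)" for x
  have derF1: "(F1 has_field_derivative D x) (at x)" if "norm x \<le> 1" for x
  proof -
    have "(F has_field_derivative deriv F (\<kappa> * x)) (at (\<kappa> * x))"
      using hol inball[OF that] by (meson holomorphic_derivI open_ball)
    moreover have "((*) \<kappa> has_field_derivative \<kappa>) (at x)"
      by (auto intro!: derivative_eq_intros)
    ultimately have "((\<lambda>x. F (\<kappa> * x)) has_field_derivative deriv F (\<kappa> * x) * \<kappa>) (at x)"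
      by (rule DERIV_chain2)
    then show ?thesis unfolding F1_def[abs_def] D_def by (simp only: mult.commute)
  qed
  have derivF1: "deriv F1 x = D x" if "norm x \<le> 1" for x using derF1[OF that] by (rule DERIV_imp_deriv)
  have holF1: "F1 holomorphic_on ball 0 1"
    unfolding holomorphic_on_open[OF open_ball] by (auto intro!: exI derF1 less_imp_le)
  have contF1: "continuous_on (cball 0 1) F1"
    by (intro continuous_at_imp_continuous_on ballI) (auto intro!: DERIV_isCont[OF derF1])
  have holdF: "deriv F holomorphic_on ball 0 1" using hol by (intro holomorphic_deriv) auto
  have contD: "continuous_on (cball 0 1) D"
    unfolding D_def
    by (intro continuous_intros continuous_on_compose2[OF holomorphic_on_imp_continuous_on[OF holdF]])
      (use inball in auto)
  have holD: "D holomorphic_on ball 0 1"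
    unfolding D_def
    by (intro holomorphic_intros holomorphic_on_compose_gen[OF _ holdF, unfolded o_def])
      (use inball in \<open>auto simp: less_imp_le\<close>)
  define Q where "Q x = D x * (x\<^sup>2 - 2 * of_real (cos \<gamma>) * x + 1)" for x
  have Qpos: "Re (Q x) > 0" if x: "x \<in> ball 0 1" for x
  proof (rule Re_pos_of_boundary[OF _ _ _ _ _ _ x])
    show "Q holomorphic_on ball 0 1" unfolding Q_def by (intro holomorphic_intros holD)
    show "continuous_on (cball 0 1) Q" unfolding Q_def by (intro continuous_intros contD)
    show "norm (cis \<gamma>) = 1" by simp
    have "(cis \<gamma>)\<^sup>2 - 2 * of_real (cos \<gamma>) * cis \<gamma> + 1 = 0"
    proof -
      have "2 * of_real (cos \<gamma>) = cis \<gamma> + cis (- \<gamma>)" by (simp add: complex_eq_iff)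
      then show ?thesis by (simp add: power2_eq_square distrib_right cis_mult)
    qed
    then show "Q (cis \<gamma>) = 0" by (simp add: Q_def)
    show "Q 0 \<noteq> 0" using nz[of 0] \<kappa>0 by (simp add: Q_def D_def)
  next
    fix y :: complex assume y: "norm y = 1"
    \<comment> \<open>The argument is normalised to start at \<open>- \<gamma>\<close>, so that the
      two arcs are told apart by comparing \<tau> with \<gamma>.\<close>
    obtain \<tau> where \<tau>: "- \<gamma> \<le> \<tau>" "\<tau> \<le> 2 * pi - \<gamma>" "y = cis \<tau>"
    proof -
      have "y \<noteq> 0" using y by auto
      then have cy: "cis (Arg y) = y" using y by (simp add: cis_Arg sgn_eq)
      show thesis
      proof (cases "- \<gamma> \<le> Arg y")
        case True
        show thesis by (rule that[OF True]) (use Arg_le_pi[of y] \<gamma> cy in auto)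
      next
        case False
        show thesis
          by (rule that[of "Arg y + 2 * pi"])
            (use False mpi_less_Arg[of y] \<gamma> cy in \<open>auto simp flip: cis_mult\<close>)
      qed
    qed
    have yy: "y\<^sup>2 + 1 = 2 * of_real (Re y) * y"
    proof -
      have "y * cnj y = 1" using y complex_norm_square[of y] by simp
      then have "y\<^sup>2 + 1 = (y + cnj y) * y" by (simp add: power2_eq_square algebra_simps)
      then show ?thesis by (simp add: complex_add_cnj)
    qed
    have "Q y = of_real (2 * (Re y - cos \<gamma>)) * (y * D y)"
    proof -
      have "Q y = D y * ((y\<^sup>2 + 1) - 2 * of_real (cos \<gamma>) * y)" by (simp add: Q_def)
      then show ?thesis unfolding yy by (simp add: algebra_simps)
    qed
    then have ReQ: "Re (Q y) = 2 * (cos \<tau> - cos \<gamma>) * Re (y * D y)"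
      using \<tau>(3) by (simp only: Re_of_real_mult) simp
    have "y * D y = of_real \<rho> * cis (\<sigma> + \<tau>) * deriv F (of_real \<rho> * cis (\<sigma> + \<tau>))"
      by (simp add: D_def \<kappa>_def \<tau>(3) mult_ac flip: cis_mult)
    note yD = arg_cong[OF this, of Re]
    show "Re (Q y) \<ge> 0"
    proof (cases "\<tau> \<le> \<gamma>")
      case True
      have "Re (y * D y) \<ge> 0" unfolding yD
        by (rule inc) (use True \<tau> in \<open>auto simp: \<sigma>_def \<gamma>_def field_simps\<close>)
      moreover have "cos \<tau> - cos \<gamma> \<ge> 0" using cos_diff_sign(1)[OF \<gamma>] True \<tau> by simp
      ultimately show ?thesis unfolding ReQ by simp
    next
      case False
      have "Re (y * D y) \<le> 0" unfolding yD
        by (rule dec) (use False \<tau> in \<open>auto simp: \<sigma>_def \<gamma>_def field_simps\<close>)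
      moreover have "cos \<tau> - cos \<gamma> \<le> 0" using cos_diff_sign(2)[OF \<gamma>] False \<tau> by simp
      ultimately show ?thesis unfolding ReQ by (simp add: mult_nonpos_nonpos)
    qed
  qed
  have pos: "Re (deriv F1 x * (x\<^sup>2 - 2 * of_real (cos \<gamma>) * x + 1)) > 0" if "x \<in> ball 0 1" for x
    using Qpos[OF that] derivF1[of x] that by (simp add: Q_def)
  note res = convex_in_one_direction[OF holF1 contF1 \<gamma> pos]
  have img: "ball 0 \<rho> = (*) \<kappa> ` ball 0 1"
  proof (intro equalityI subsetI)
    fix z :: complex assume z: "z \<in> ball 0 \<rho>"
    show "z \<in> (*) \<kappa> ` ball 0 1"
      by (rule image_eqI[of _ _ "z / \<kappa>"]) (use z \<kappa>0 n\<kappa> \<rho> in \<open>auto simp: norm_divide\<close>)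
  next
    fix z assume "z \<in> (*) \<kappa> ` ball 0 1"
    then show "z \<in> ball 0 \<rho>" using n\<kappa> \<rho> by (auto simp: norm_mult)
  qed
  have F1': "F1 = F \<circ> (*) \<kappa>" by (simp add: F1_def fun_eq_iff)
  show "inj_on F (ball 0 \<rho>)"
    unfolding img using res(1) unfolding F1' by (rule inj_on_imageI)
  show "horizontally_convex (F ` ball 0 \<rho>)"
    unfolding img using res(2) unfolding F1' image_comp .
qed

text \<open>Multiply by the conjugate of the denominator. The formula serves both the lower bound on
  the slope of the tangent angle and the positivity required by the shear.\<close>

lemma Re_Cayley:
  assumes "w \<noteq> 1"
  shows "Re ((1 + w) / (1 - w)) = (1 - (norm w)\<^sup>2) / (norm (1 - w))\<^sup>2"
proof -
  have "(1 + w) / (1 - w) = (1 + w) * cnj (1 - w) / of_real ((norm (1 - w))\<^sup>2)"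
    by (subst complex_div_cnj) simp
  then have "Re ((1 + w) / (1 - w)) = Re ((1 + w) * cnj (1 - w)) / (norm (1 - w))\<^sup>2"
    by (simp only: Re_divide_of_real)
  also have "Re ((1 + w) * cnj (1 - w)) = 1 - (norm w)\<^sup>2"
    unfolding cmod_power2 by (simp add: algebra_simps power2_eq_square)
  finally show ?thesis .
qed

section \<open>The tangent angle of the harmonic map\<close>

text \<open>
  Up to a quarter turn, \<open>\<psi>\<close> is the angle of the tangent to \<open>\<theta> \<mapsto> f(\<rho> e\<^sup>i\<^sup>\<theta>)\<close>, where \<open>h' = exp H\<close>. With
  \<open>\<phi> = arg(z h')\<close> and \<open>u = \<rho>\<^sup>n e\<^sup>-\<^sup>i\<^sup>(\<^sup>n\<^sup>\<theta>\<^sup>+\<^sup>2\<^sup>\<phi>\<^sup>)\<close> one has \<open>\<psi> = \<phi> + arg(1 - u)\<close>, and then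
  \<open>\<psi>' = \<phi>' P + n (P - 1) / 2\<close> with \<open>P = Re ((1 + u) / (1 - u)) \<ge> (1 - \<rho>\<^sup>n) / (1 + \<rho>\<^sup>n)\<close>.
\<close>
lemma tangent_angle:
  fixes \<alpha> \<rho> :: real and n :: nat
  assumes \<alpha>: "- 1 / 2 < \<alpha>" "\<alpha> < 0" and n: "n \<ge> 2" and H: "H holomorphic_on ball 0 1"
    and HRe: "\<And>z. z \<in> ball 0 1 \<Longrightarrow> Re (1 + z * deriv H z) > \<alpha>"
    and \<rho>: "0 < \<rho>" "\<rho> < 1" and \<rho>n: "\<rho> ^ n * (1 + 2 * real n + 2 * \<alpha>) = 1 + 2 * \<alpha>"
  obtains \<psi> \<psi>' :: "real \<Rightarrow> real"
  where "\<And>\<theta>. (\<psi> has_real_derivative \<psi>' \<theta>) (at \<theta>)" "continuous_on UNIV \<psi>'"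
    "\<And>\<theta>. \<psi> (\<theta> + 2 * pi) = \<psi> \<theta> + 2 * pi" "\<And>\<theta>. \<psi>' \<theta> > - 1 / 2"
    "\<And>\<theta> z h'. z = of_real \<rho> * cis \<theta> \<Longrightarrow> h' = exp (H z) \<Longrightarrow>
      \<exists>A>0. z * h' - cnj (z ^ (n + 1) * h') = of_real A * cis (\<psi> \<theta>)"
proof -
  define q where "q = \<rho> ^ n"
  have q01: "0 < q" "q < 1" using \<rho> n by (auto simp: q_def power_less_one_iff)
  define Z where "Z \<theta> = of_real \<rho> * cis \<theta>" for \<theta>
  have Zb: "Z \<theta> \<in> ball 0 1" for \<theta> using \<rho> by (simp add: Z_def norm_mult)
  have derZ: "(Z has_vector_derivative \<i> * Z \<theta>) (at \<theta>)" for \<theta>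
    using has_vector_derivative_mult_right[OF has_vector_derivative_cis[OF DERIV_ident], of "of_real \<rho>" \<theta>]
    by (simp add: Z_def[abs_def] mult_ac)
  define \<phi> where "\<phi> \<theta> = \<theta> + Im (H (Z \<theta>))" for \<theta>
  define \<phi>' where "\<phi>' \<theta> = Re (1 + Z \<theta> * deriv H (Z \<theta>))" for \<theta>
  \<comment> \<open>Factoring \<open>z * h'\<close> out of
    \<open>z * h' - cnj (z ^ (n + 1) * h')\<close> leaves \<open>1 - u\<close>; conjugation reverses
    the angle \<phi>, which is why it appears doubled.\<close>
  define u where "u \<theta> = of_real q * cis (- (real n * \<theta> + 2 * \<phi> \<theta>))" for \<theta>
  have nu: "norm (u \<theta>) = q" for \<theta> using q01 by (simp add: u_def norm_mult)
  have nu1: "u \<theta> \<noteq> 1" for \<theta> using nu[of \<theta>] q01 by auto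
  define \<psi> where "\<psi> \<theta> = \<phi> \<theta> + Im (Ln (1 - u \<theta>))" for \<theta>
  define \<psi>' where "\<psi>' \<theta> = \<phi>' \<theta> + (real n + 2 * \<phi>' \<theta>) * Re (u \<theta> / (1 - u \<theta>))" for \<theta>
  have der\<phi>: "(\<phi> has_real_derivative \<phi>' \<theta>) (at \<theta>)" for \<theta>
  proof -
    have "(H has_field_derivative deriv H (Z \<theta>)) (at (Z \<theta>))"
      using H Zb by (meson holomorphic_derivI open_ball)
    from field_vector_diff_chain_at[OF derZ this]
    have "((\<lambda>\<theta>. H (Z \<theta>)) has_vector_derivative \<i> * Z \<theta> * deriv H (Z \<theta>)) (at \<theta>)" by (simp add: o_def)
    then have "((\<lambda>\<theta>. Im (H (Z \<theta>))) has_real_derivative Im (\<i> * Z \<theta> * deriv H (Z \<theta>))) (at \<theta>)"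
      by (rule has_field_derivative_Im)
    from DERIV_add[OF DERIV_ident this]
    have "(\<phi> has_real_derivative 1 + Im (\<i> * Z \<theta> * deriv H (Z \<theta>))) (at \<theta>)"
      unfolding \<phi>_def[abs_def] .
    then show ?thesis by (simp add: \<phi>'_def mult.assoc)
  qed
  \<comment> \<open>\<open>1 - u \<theta>\<close> stays in the right half-plane, where the principal
    logarithm is differentiable and single-valued. It is therefore periodic along the circle, and
    the gain of 2 pi comes from \<phi> alone.\<close>
  have Reu: "Re (1 - u \<theta>) > 0" for \<theta>
    using complex_Re_le_cmod[of "u \<theta>"] nu[of \<theta>] q01 by simp
  have der\<psi>: "(\<psi> has_real_derivative \<psi>' \<theta>) (at \<theta>)" for \<theta>
  proof -
    have "((\<lambda>\<theta>. - (real n * \<theta> + 2 * \<phi> \<theta>)) has_real_derivative - (real n + 2 * \<phi>' \<theta>)) (at \<theta>)"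
      by (auto intro!: derivative_eq_intros der\<phi>)
    from has_vector_derivative_mult_right[OF has_vector_derivative_cis[OF this], of "of_real q"]
    have "(u has_vector_derivative of_real q * (of_real (- (real n + 2 * \<phi>' \<theta>)) * (\<i> * cis (- (real n * \<theta> + 2 * \<phi> \<theta>))))) (at \<theta>)"
      unfolding u_def[abs_def] .
    also have "of_real q * (of_real (- (real n + 2 * \<phi>' \<theta>)) * (\<i> * cis (- (real n * \<theta> + 2 * \<phi> \<theta>))))
        = - (\<i> * of_real (real n + 2 * \<phi>' \<theta>) * u \<theta>)"
      unfolding u_def of_real_minus by (simp only: mult_minus_left mult_minus_right mult_ac)
    finally have "(u has_vector_derivative - (\<i> * of_real (real n + 2 * \<phi>' \<theta>) * u \<theta>)) (at \<theta>)" .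
    then have 1: "((\<lambda>\<theta>. 1 - u \<theta>) has_vector_derivative \<i> * of_real (real n + 2 * \<phi>' \<theta>) * u \<theta>) (at \<theta>)"
      by (auto intro!: derivative_eq_intros)
    have "(Ln has_field_derivative inverse (1 - u \<theta>)) (at (1 - u \<theta>))"
      by (rule has_field_derivative_Ln) (use Reu[of \<theta>] in \<open>auto simp: complex_nonpos_Reals_iff\<close>)
    from field_vector_diff_chain_at[OF 1 this]
    have "((\<lambda>\<theta>. Ln (1 - u \<theta>)) has_vector_derivative \<i> * of_real (real n + 2 * \<phi>' \<theta>) * u \<theta> * inverse (1 - u \<theta>)) (at \<theta>)"
      by (simp add: o_def)
    then have "((\<lambda>\<theta>. Im (Ln (1 - u \<theta>))) has_real_derivative Im (\<i> * of_real (real n + 2 * \<phi>' \<theta>) * u \<theta> * inverse (1 - u \<theta>))) (at \<theta>)"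
      by (rule has_field_derivative_Im)
    moreover have "\<i> * of_real (real n + 2 * \<phi>' \<theta>) * u \<theta> * inverse (1 - u \<theta>)
        = \<i> * (of_real (real n + 2 * \<phi>' \<theta>) * (u \<theta> / (1 - u \<theta>)))"
      by (simp only: divide_inverse mult.assoc)
    ultimately have "((\<lambda>\<theta>. Im (Ln (1 - u \<theta>))) has_real_derivative (real n + 2 * \<phi>' \<theta>) * Re (u \<theta> / (1 - u \<theta>))) (at \<theta>)"
      by (simp only: Im_i_times Re_of_real_mult)
    from DERIV_add[OF der\<phi> this] show ?thesis unfolding \<psi>_def[abs_def] \<psi>'_def .
  qed
  have contZ: "continuous_on UNIV Z" unfolding Z_def by (intro continuous_intros)
  have cont\<phi>: "continuous_on UNIV \<phi>"
    using der\<phi> by (meson DERIV_isCont continuous_at_imp_continuous_on)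
  have dH: "deriv H holomorphic_on ball 0 1" using H by (intro holomorphic_deriv) auto
  have "continuous_on UNIV (\<lambda>\<theta>. deriv H (Z \<theta>))"
    by (rule continuous_on_compose2[OF holomorphic_on_imp_continuous_on[OF dH] contZ]) (use Zb in blast)
  then have cont\<phi>': "continuous_on UNIV \<phi>'"
    unfolding \<phi>'_def by (intro continuous_intros contZ)
  have contu: "continuous_on UNIV u" unfolding u_def by (intro continuous_intros cont\<phi>)
  have cont\<psi>': "continuous_on UNIV \<psi>'"
    unfolding \<psi>'_def by (intro continuous_intros cont\<phi>' contu) (use nu1 in auto)
  have Zper: "Z (\<theta> + 2 * pi) = Z \<theta>" for \<theta> by (simp add: Z_def flip: cis_mult)
  have \<phi>per: "\<phi> (\<theta> + 2 * pi) = \<phi> \<theta> + 2 * pi" for \<theta> by (simp add: \<phi>_def Zper)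
  have uper: "u (\<theta> + 2 * pi) = u \<theta>" for \<theta>
  proof -
    have "- (real n * (\<theta> + 2 * pi) + 2 * \<phi> (\<theta> + 2 * pi))
        = - (real n * \<theta> + 2 * \<phi> \<theta>) + 2 * pi * of_int (- (int n + 2))"
      unfolding \<phi>per by (simp add: algebra_simps)
    moreover have "cis (x + 2 * pi * of_int k) = cis x" for x k
      by (simp add: cis_multiple_2pi flip: cis_mult)
    ultimately show ?thesis unfolding u_def by (simp only:)
  qed
  have \<psi>per: "\<psi> (\<theta> + 2 * pi) = \<psi> \<theta> + 2 * pi" for \<theta> by (simp add: \<psi>_def \<phi>per uper)
  have low: "\<psi>' \<theta> > - 1 / 2" for \<theta>
  proof -
    define R where "R = Re (u \<theta> / (1 - u \<theta>))"
    have nz: "1 - u \<theta> \<noteq> 0" using nu1[of \<theta>] by simp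
    have eq: "(1 + u \<theta>) / (1 - u \<theta>) = 1 + 2 * (u \<theta> / (1 - u \<theta>))" using nz by (simp add: field_simps)
    have "Re (1 + 2 * x) = 1 + 2 * Re x" for x by simp
    then have "1 + 2 * R = Re ((1 + u \<theta>) / (1 - u \<theta>))" unfolding R_def eq by (rule sym)
    then have R1: "1 + 2 * R = (1 - q\<^sup>2) / (norm (1 - u \<theta>))\<^sup>2"
      unfolding Re_Cayley[OF nu1] nu .
    have npos: "norm (1 - u \<theta>) > 0" using nz by simp
    have "norm (1 - u \<theta>) \<le> 1 + q" using norm_triangle_ineq4[of 1 "u \<theta>"] nu by simp
    then have "(norm (1 - u \<theta>))\<^sup>2 \<le> (1 + q)\<^sup>2" by (intro power_mono) auto
    moreover have q2: "1 - q\<^sup>2 > 0" using q01 by (simp add: power_less_one_iff)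
    ultimately have "(1 - q\<^sup>2) / (1 + q)\<^sup>2 \<le> 1 + 2 * R"
      unfolding R1 using npos by (intro divide_left_mono) (auto intro!: mult_pos_pos simp: q01 add_pos_pos)
    moreover have "(1 - q\<^sup>2) / (1 + q)\<^sup>2 = (1 - q) / (1 + q)"
      using q01 by (simp add: power2_eq_square divide_simps) (simp add: algebra_simps)
    ultimately have "(1 - q) / (1 + q) \<le> 1 + 2 * R" by simp
    \<comment> \<open>The extreme value \<open>- q / (1 + q)\<close> of \<open>R\<close> belongs to
      \<open>u \<theta> = - q\<close>.\<close>
    then have R2: "- q \<le> R * (1 + q)" using q01 by (simp add: field_simps)
    have R3: "1 + 2 * R > 0" unfolding R1 using q2 npos by simp
    have "\<phi>' \<theta> > \<alpha>" unfolding \<phi>'_def by (rule HRe[OF Zb])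
    then have "\<phi>' \<theta> * (1 + 2 * R) > \<alpha> * (1 + 2 * R)" using R3 by (rule mult_strict_right_mono)
    then have "\<psi>' \<theta> > \<alpha> + (2 * \<alpha> + n) * R"
      unfolding \<psi>'_def R_def[symmetric] by (simp add: algebra_simps)
    \<comment> \<open>Here the radius enters. The coefficient of \<open>R\<close> is positive, so
      the lower bound on \<open>R\<close> may be inserted; after multiplication by
      \<open>1 + q\<close> the equation \<open>\<rho>n\<close> reduces the result to exactly
      \<open>q\<close>, which is positive.\<close>
    moreover have "\<alpha> + (2 * \<alpha> + n) * R \<ge> - 1 / 2"
    proof -
      have "(2 * \<alpha> + n) * (R * (1 + q)) \<ge> (2 * \<alpha> + n) * (- q)"
        using R2 \<alpha> n by (intro mult_left_mono) auto
      moreover have "(a + X * R + b) * (1 + q) = (a + b) * (1 + q) + X * (R * (1 + q))" for a b X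
        by (simp add: algebra_simps)
      ultimately have "(\<alpha> + (2 * \<alpha> + n) * R + 1 / 2) * (1 + q) \<ge> (\<alpha> + 1 / 2) * (1 + q) - (2 * \<alpha> + n) * q"
        by simp
      also have "(\<alpha> + 1 / 2) * (1 + q) - (2 * \<alpha> + n) * q = q"
        using \<rho>n unfolding q_def[symmetric] by (simp add: field_simps)
      finally have "(\<alpha> + (2 * \<alpha> + n) * R + 1 / 2) * (1 + q) > 0" using q01 by linarith
      then have "\<alpha> + (2 * \<alpha> + n) * R + 1 / 2 > 0" using q01 by (simp add: zero_less_mult_iff)
      then show ?thesis by simp
    qed
    ultimately show ?thesis by linarith
  qed
  have rep: "\<exists>A>0. z * h' - cnj (z ^ (n + 1) * h') = of_real A * cis (\<psi> \<theta>)"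
    if z: "z = of_real \<rho> * cis \<theta>" and h': "h' = exp (H z)" for \<theta> z h'
  proof -
    have zZ: "z = Z \<theta>" using z by (simp add: Z_def)
    define B where "B = \<rho> * exp (Re (H z))"
    have B: "B > 0" using \<rho> by (simp add: B_def)
    have zh: "z * h' = of_real B * cis (\<phi> \<theta>)"
    proof -
      have "h' = of_real (exp (Re (H z))) * cis (Im (H z))"
        unfolding h' by (rule exp_eq_polar)
      then show ?thesis unfolding \<phi>_def zZ[symmetric] B_def by (subst z) (simp add: mult_ac flip: cis_mult)
    qed
    have zn: "z ^ n = of_real q * cis (real n * \<theta>)"
      unfolding z q_def by (simp add: power_mult_distrib Complex.DeMoivre)
    have "cnj (z ^ (n + 1) * h') = cnj (z ^ n * (z * h'))" by (simp add: mult_ac)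
    also have "\<dots> = of_real B * (of_real q * (cis (- (real n * \<theta>)) * cis (- \<phi> \<theta>)))"
      unfolding zh zn by (simp add: cis_cnj mult_ac)
    also have "cis (- (real n * \<theta>)) * cis (- \<phi> \<theta>) = cis (\<phi> \<theta>) * cis (- (real n * \<theta> + 2 * \<phi> \<theta>))"
      by (simp add: cis_mult algebra_simps)
    finally have "z * h' - cnj (z ^ (n + 1) * h') = of_real B * cis (\<phi> \<theta>) * (1 - u \<theta>)"
      unfolding zh u_def by (simp add: algebra_simps)
    also have "1 - u \<theta> = of_real (norm (1 - u \<theta>)) * cis (Im (Ln (1 - u \<theta>)))"
    proof -
      have "1 - u \<theta> \<noteq> 0" using nu1[of \<theta>] by simp
      then have "1 - u \<theta> = exp (Ln (1 - u \<theta>))" by simp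
      also have "\<dots> = of_real (exp (Re (Ln (1 - u \<theta>)))) * cis (Im (Ln (1 - u \<theta>)))" by (rule exp_eq_polar)
      also have "exp (Re (Ln (1 - u \<theta>))) = norm (1 - u \<theta>)" using \<open>1 - u \<theta> \<noteq> 0\<close> by simp
      finally show ?thesis .
    qed
    finally have "z * h' - cnj (z ^ (n + 1) * h') = of_real (B * norm (1 - u \<theta>)) * cis (\<psi> \<theta>)"
      unfolding \<psi>_def by (simp add: mult_ac flip: cis_mult)
    moreover have "B * norm (1 - u \<theta>) > 0" using B nu1[of \<theta>] by simp
    ultimately show ?thesis by blast
  qed
  show thesis
    by (rule that[of \<psi> \<psi>']) (fact der\<psi> cont\<psi>' \<psi>per low rep)+
qed

section \<open>Choice of the direction, shear, and rotation back\<close>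

theorem theorem3p5:
  fixes h g :: "complex \<Rightarrow> complex" and \<alpha> :: real and n :: nat
  assumes "-1/2 < \<alpha>" and "\<alpha> < 0" and "n \<ge> 2"
    and "h holomorphic_on ball 0 1" and "g holomorphic_on ball 0 1"
    and "\<And>z. z \<in> ball 0 1 \<Longrightarrow> deriv h z \<noteq> 0"
    and "\<And>z. z \<in> ball 0 1 \<Longrightarrow> Re (1 + z * deriv (deriv h) z / deriv h z) > \<alpha>"
    and "\<And>z. z \<in> ball 0 1 \<Longrightarrow> deriv g z = z ^ n * deriv h z"
  shows "close_to_convex_in (\<lambda>z. h z + cnj (g z))
           (ball 0 (root n ((1 + 2 * \<alpha>) / (1 + 2 * real n + 2 * \<alpha>))))"
proof -
  define \<rho> where "\<rho> = root n ((1 + 2 * \<alpha>) / (1 + 2 * real n + 2 * \<alpha>))"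
  have frac: "0 < (1 + 2 * \<alpha>) / (1 + 2 * real n + 2 * \<alpha>)" "(1 + 2 * \<alpha>) / (1 + 2 * real n + 2 * \<alpha>) < 1"
    using assms(1-3) by (auto simp: field_simps)
  have \<rho>: "0 < \<rho>" "\<rho> < 1" using frac assms(3) by (auto simp: \<rho>_def)
  have "\<rho> ^ n = (1 + 2 * \<alpha>) / (1 + 2 * real n + 2 * \<alpha>)"
    unfolding \<rho>_def using frac assms(3) by (intro real_root_pow_pos2) auto
  then have q: "\<rho> ^ n * (1 + 2 * real n + 2 * \<alpha>) = 1 + 2 * \<alpha>"
    using assms(1) by (simp add: field_simps)
  have dh: "(h has_field_derivative deriv h z) (at z)" and dg: "(g has_field_derivative deriv g z) (at z)"
    if "z \<in> ball 0 1" for z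
    using assms(4,5) that by (meson holomorphic_derivI open_ball)+
  have holdh: "deriv h holomorphic_on ball 0 1" using assms(4) by (intro holomorphic_deriv) auto
  \<comment> \<open>The derivative of \<open>h\<close> has no zero in the disc and so has a
    holomorphic logarithm \<open>H\<close>; the quotient in the hypothesis becomes
    \<open>z * deriv H z\<close>.\<close>
  obtain H where H: "H holomorphic_on ball 0 1" "\<And>z. z \<in> ball 0 1 \<Longrightarrow> deriv h z = exp (H z)"
    using contractible_imp_holomorphic_log[OF holdh convex_imp_contractible[OF convex_ball] assms(6)] by blast
  have HRe: "Re (1 + z * deriv H z) > \<alpha>" if z: "z \<in> ball 0 1" for z
  proof -
    have "(H has_field_derivative deriv H z) (at z)"
      using H(1) z by (meson holomorphic_derivI open_ball)
    then have "((\<lambda>z. exp (H z)) has_field_derivative exp (H z) * deriv H z) (at z)"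
      by (auto intro!: derivative_eq_intros)
    then have "(deriv h has_field_derivative exp (H z) * deriv H z) (at z)"
      by (rule has_field_derivative_transform_within_open[OF _ open_ball z]) (simp add: H)
    then have "deriv (deriv h) z = exp (H z) * deriv H z" by (rule DERIV_imp_deriv)
    then show ?thesis using assms(7)[OF z] H(2)[OF z] by simp
  qed
  obtain \<psi> \<psi>' where \<psi>: "\<And>\<theta>. (\<psi> has_real_derivative \<psi>' \<theta>) (at \<theta>)" "continuous_on UNIV \<psi>'"
    "\<And>\<theta>. \<psi> (\<theta> + 2 * pi) = \<psi> \<theta> + 2 * pi" "\<And>\<theta>. \<psi>' \<theta> > - 1 / 2"
    and rep: "\<And>\<theta> z h'. z = of_real \<rho> * cis \<theta> \<Longrightarrow> h' = exp (H z) \<Longrightarrow>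
      \<exists>A>0. z * h' - cnj (z ^ (n + 1) * h') = of_real A * cis (\<psi> \<theta>)"
    using tangent_angle[OF assms(1-3) H(1) HRe \<rho> q] by metis
  obtain c s t where st: "s < t" "t < s + 2 * pi"
    and up: "\<And>x. s \<le> x \<Longrightarrow> x \<le> t \<Longrightarrow> c \<le> \<psi> x \<and> \<psi> x \<le> c + pi"
    and down: "\<And>x. t \<le> x \<Longrightarrow> x \<le> s + 2 * pi \<Longrightarrow> c + pi \<le> \<psi> x \<and> \<psi> x \<le> c + 2 * pi"
    using half_turns[of \<psi> \<psi>', OF \<psi>] by metis
  \<comment> \<open>With this choice
    \<open>cos (\<psi> \<theta> - \<beta>) = sin (\<psi> \<theta> - c)\<close>, which is nonnegative
    on the first arc and nonpositive on the second.\<close>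
  define \<beta> where "\<beta> = c + pi / 2"
  define F where "F z = cis (- \<beta>) * h z - cis \<beta> * g z" for z
  define F2 where "F2 z = cis (- \<beta>) * h z + cis \<beta> * g z" for z
  \<comment> \<open>The derivatives of \<open>F\<close> and \<open>F2\<close> are
    \<open>cis (- \<beta>) * deriv h z\<close> times \<open>1 - \<omega> z\<close> and
    \<open>1 + \<omega> z\<close>. As \<omega> has modulus below 1, their quotient has positive real
    part.\<close>
  define \<omega> where "\<omega> z = cis \<beta> * cis \<beta> * z ^ n" for z
  have n\<omega>: "norm (\<omega> z) < 1" if "z \<in> ball 0 1" for z
    using that assms(3) by (simp add: \<omega>_def norm_mult norm_power power_less_one_iff)
  have holF: "F holomorphic_on ball 0 1" unfolding F_def by (intro holomorphic_intros assms)
  have holF2: "F2 holomorphic_on ball 0 1" unfolding F2_def by (intro holomorphic_intros assms)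
  have cc: "cis (- \<beta>) * (cis \<beta> * cis \<beta>) = cis \<beta>" by (simp add: cis_mult)
  have derF: "deriv F z = cis (- \<beta>) * deriv h z * (1 - \<omega> z)" if z: "z \<in> ball 0 1" for z
  proof -
    have "deriv F z = cis (- \<beta>) * deriv h z - cis \<beta> * deriv g z"
      unfolding F_def by (rule DERIV_imp_deriv) (auto intro!: derivative_eq_intros dh dg z)
    also have "\<dots> = cis (- \<beta>) * deriv h z - cis (- \<beta>) * (cis \<beta> * cis \<beta>) * (z ^ n * deriv h z)"
      unfolding cc using assms(8)[OF z] by simp
    finally show ?thesis by (simp add: \<omega>_def algebra_simps)
  qed
  have derF2: "deriv F2 z = cis (- \<beta>) * deriv h z * (1 + \<omega> z)" if z: "z \<in> ball 0 1" for z
  proof -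
    have "deriv F2 z = cis (- \<beta>) * deriv h z + cis \<beta> * deriv g z"
      unfolding F2_def by (rule DERIV_imp_deriv) (auto intro!: derivative_eq_intros dh dg z)
    also have "\<dots> = cis (- \<beta>) * deriv h z + cis (- \<beta>) * (cis \<beta> * cis \<beta>) * (z ^ n * deriv h z)"
      unfolding cc using assms(8)[OF z] by simp
    finally show ?thesis by (simp add: \<omega>_def algebra_simps)
  qed
  have nz: "deriv F z \<noteq> 0" if "z \<in> ball 0 1" for z
    using derF[OF that] assms(6)[OF that] n\<omega>[OF that] by auto
  \<comment> \<open>The left-hand side is the derivative of \<open>Im F\<close> along the circle in
    \<theta>. Conjugating the term from \<open>g\<close> leaves its real part unchanged and produces
    the expression that \<open>tangent_angle\<close> writes in polar form.\<close>
  have bdry: "\<exists>A>0. Re (z * deriv F z) = A * sin (\<psi> \<theta> - c)" if z: "z = of_real \<rho> * cis \<theta>" for z \<theta>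
  proof -
    have zb: "z \<in> ball 0 1" using \<rho> by (simp add: z norm_mult)
    obtain A where A: "A > 0" "z * deriv h z - cnj (z ^ (n + 1) * deriv h z) = of_real A * cis (\<psi> \<theta>)"
      using rep[OF z H(2)[OF zb]] by blast
    have "z * deriv F z = cis (- \<beta>) * (z * deriv h z) - cis \<beta> * (z ^ (n + 1) * deriv h z)"
    proof -
      have "z * deriv F z = cis (- \<beta>) * (z * deriv h z) - cis (- \<beta>) * (cis \<beta> * cis \<beta>) * (z ^ (n + 1) * deriv h z)"
        unfolding derF[OF zb] by (simp add: \<omega>_def algebra_simps)
      then show ?thesis unfolding cc .
    qed
    moreover have "Re (cis \<beta> * v) = Re (cis (- \<beta>) * cnj v)" for v by simp
    ultimately have "Re (z * deriv F z) = Re (cis (- \<beta>) * (z * deriv h z - cnj (z ^ (n + 1) * deriv h z)))"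
      by (simp only: minus_complex.sel right_diff_distrib)
    also have "\<dots> = Re (of_real A * cis (\<psi> \<theta> - \<beta>))"
      unfolding A(2) by (simp only: mult.left_commute[of "cis (- \<beta>)"] cis_mult) simp
    also have "\<dots> = A * cos (\<psi> \<theta> - \<beta>)" by simp
    also have "cos (\<psi> \<theta> - \<beta>) = sin (\<psi> \<theta> - c)"
      by (simp add: \<beta>_def sin_cos_eq) (metis cos_minus minus_diff_eq add_diff_eq diff_diff_eq2 add.commute)
    finally show ?thesis using A(1) by blast
  qed
  have inc: "Re (of_real \<rho> * cis \<theta> * deriv F (of_real \<rho> * cis \<theta>)) \<ge> 0" if "s \<le> \<theta>" "\<theta> \<le> t" for \<theta>
  proof -
    obtain A where A: "A > 0" "Re (of_real \<rho> * cis \<theta> * deriv F (of_real \<rho> * cis \<theta>)) = A * sin (\<psi> \<theta> - c)"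
      using bdry[OF refl, of \<theta>] by blast
    have "sin (\<psi> \<theta> - c) \<ge> 0" using up[OF that] by (intro sin_ge_zero) auto
    then show ?thesis unfolding A(2) using A(1) by simp
  qed
  have dec: "Re (of_real \<rho> * cis \<theta> * deriv F (of_real \<rho> * cis \<theta>)) \<le> 0" if "t \<le> \<theta>" "\<theta> \<le> s + 2 * pi" for \<theta>
  proof -
    have "sin (\<psi> \<theta> - c - pi) \<ge> 0" using down[OF that] by (intro sin_ge_zero) auto
    then have "sin (\<psi> \<theta> - c) \<le> 0" by (simp add: sin_diff)
    moreover obtain A where A: "A > 0" "Re (of_real \<rho> * cis \<theta> * deriv F (of_real \<rho> * cis \<theta>)) = A * sin (\<psi> \<theta> - c)"
      using bdry[OF refl, of \<theta>] by blast
    ultimately show ?thesis unfolding A(2) using A(1) by (simp add: mult_nonneg_nonpos)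
  qed
  note uni = unimodal_boundary_imp_convex_in_one_direction[OF holF nz \<rho> st inc dec]
  have sub: "ball 0 \<rho> \<subseteq> ball (0::complex) 1" "cball 0 \<rho> \<subseteq> ball (0::complex) 1" using \<rho> by auto
  define P where "P z = (1 + \<omega> z) / (1 - \<omega> z)" for z
  define f where "f z = h z + cnj (g z)" for z
  have P: "deriv F2 z = P z * deriv F z" "Re (P z) > 0" if "z \<in> ball 0 \<rho>" for z
  proof -
    have z: "z \<in> ball 0 1" using that sub by blast
    have n1: "\<omega> z \<noteq> 1" "1 - \<omega> z \<noteq> 0" using n\<omega>[OF z] by auto
    show "deriv F2 z = P z * deriv F z" using derF[OF z] derF2[OF z] n1 by (simp add: P_def)
    have "(norm (\<omega> z))\<^sup>2 < 1" using n\<omega>[OF z] by (simp add: power_less_one_iff)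
    then show "Re (P z) > 0" unfolding P_def Re_Cayley[OF n1(1)] using n1 by simp
  qed
  \<comment> \<open>\<open>cis \<beta> * g z\<close> and \<open>cis (- \<beta>) * cnj (g z)\<close>
    are conjugate, so they share the real part and have opposite imaginary parts.\<close>
  have rot: "Complex (Re (F2 z)) (Im (F z)) = cis (- \<beta>) * f z" for z
    by (simp add: F_def F2_def f_def complex_eq_iff algebra_simps)
  note shear = horizontal_shear[OF holomorphic_on_subset[OF holF sub(1)] holomorphic_on_subset[OF holF2 sub(1)]
      open_ball uni P, unfolded rot]
  have inj: "inj_on f (ball 0 \<rho>)" using shear(1) by (auto simp: inj_on_def)
  have contf: "continuous_on (cball 0 \<rho>) (\<lambda>z. cis (- \<beta>) * f z)"
    unfolding f_def
    by (intro continuous_intros continuous_on_subset[OF holomorphic_on_imp_continuous_on sub(2)] assms)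
  then have contf': "continuous_on (ball 0 \<rho>) (\<lambda>z. cis (- \<beta>) * f z)"
    using ball_subset_cball continuous_on_subset by blast
  have "close_to_convex_domain ((\<lambda>z. cis (- \<beta>) * f z) ` ball 0 \<rho>)"
  proof (rule horizontally_convex_imp_close_to_convex_domain)
    \<comment> \<open>The map is not holomorphic in general, so openness comes from continuity and
      injectivity through invariance of domain.\<close>
    show "open ((\<lambda>z. cis (- \<beta>) * f z) ` ball 0 \<rho>)"
      by (rule invariance_of_domain[OF contf' open_ball shear(1)])
    show "bounded ((\<lambda>z. cis (- \<beta>) * f z) ` ball 0 \<rho>)"
      using compact_imp_bounded[OF compact_continuous_image[OF contf compact_cball]]
      by (rule bounded_subset) (intro image_mono ball_subset_cball)
    show "connected ((\<lambda>z. cis (- \<beta>) * f z) ` ball 0 \<rho>)"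
      by (intro connected_continuous_image contf' connected_ball)
    show "(\<lambda>z. cis (- \<beta>) * f z) ` ball 0 \<rho> \<noteq> {}" using \<rho> by simp
  qed (rule shear(2))
  then have "close_to_convex_domain ((*) (cis \<beta>) ` ((\<lambda>z. cis (- \<beta>) * f z) ` ball 0 \<rho>))"
    by (rule close_to_convex_domain_rotate) simp
  moreover have "(*) (cis \<beta>) ` ((\<lambda>z. cis (- \<beta>) * f z) ` ball 0 \<rho>) = f ` ball 0 \<rho>"
    unfolding image_image by (simp add: cis_mult flip: mult.assoc)
  ultimately show ?thesis
    using inj unfolding close_to_convex_in_def \<rho>_def[symmetric] f_def[abs_def] by simp
qed

end
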